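(* Let $\Sigma$ be a simplicial fan in $N_{\mathbb R}$ whose one-dimensional cones span $N_{\mathbb R}$ as a vector space, with $m$ one-dimensional cones. Let $U(\Sigma)\subset\mathbb C^m$, $\mathcal Z(\Sigma)\subset U(\Sigma)$, $G\subset(\mathbb C^* )^m$ and $K\subset\mathbb T^m$ be the associated coordinate subspace arrangement complement, moment-angle complex (toric Kempf--Ness set), and groups (defined in the context). Then: (a) If $\Sigma$ is complete, then the composition $\mathcal Z(\Sigma)\hookrightarrow U(\Sigma)\to U(\Sigma)/G$ of the inclusion and the quotient projection induces a homeomorphism $\mathcal Z(\Sigma)/K\to U(\Sigma)/G$. (b) There is a $\mathbb T^m$-equivariant deformation retraction of $U(\Sigma)$ to $\mathcal Z(\Sigma)$.
   Context: $N\cong\mathbb Z^n$ is a lattice, $N_{\mathbb R}=N\otimes_{\mathbb Z}\mathbb R$. A cone is a set $\{\mu_1a_1+\dots+\mu_ka_k:\mu_i\in\mathbb R,\ \mu_i\ge0\}$ with $a_1,\dots,a_k\in N$; all cones are assumed strongly convex (containing no line). If $\{a_1,\dots,a_k\}$ is minimal it is called the generator set of the cone. A cone is simplicial if its generators can be chosen to be part of an $\mathbb R$-basis of $N_{\mathbb R}$. A fan $\Sigma$ is a finite (nonempty) collection of cones such that every face of a cone in $\Sigma$ is in $\Sigma$ and the intersection of any two cones of $\Sigma$ is a face of each. A fan is simplicial if all its cones are simplicial, and complete if the union of its cones is $N_{\mathbb R}$. Let the one-dimensional cones of $\Sigma$ be numbered $1,\dots,m$ and let $a_i\in N$ be the primitive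 integer vector generating the $i$-th one. For $\sigma\in\Sigma$ let $g(\sigma)\subseteq[m]=\{1,\dots,m\}$ be the set of indices $i$ such that $a_i$ is a generator of $\sigma$ (i.e. spans a one-dimensional face of $\sigma$). A subset of $[m]$ is called a $g$-subset if it is contained in $g(\sigma)$ for some $\sigma\in\Sigma$. Put $\mathbb S^1=\{z\in\mathbb C:|z|=1\}$, $\mathbb T^m=(\mathbb S^1)^m$, $T_{\mathbb C}=N\otimes_{\mathbb Z}\mathbb C^*$, $T=N\otimes_{\mathbb Z}\mathbb S^1$. The map $\mathbb Z^m\to N$ sending the $i$-th standard basis vector to $a_i$ induces homomorphisms $(\mathbb C^* )^m\to T_{\mathbb C}$ and $\mathbb T^m\to T$, and $G$ and $K$ are their respective kernels. The groups $(\mathbb C^* )^m$ and $\mathbb T^m$ act on $\mathbb C^m$ coordinatewise. Define $$U(\Sigma)=\mathbb C^m\setminus\bigcup_{\{i_1,\dots,i_k\}\text{ not a }g\text{-subset}}\{z\in\mathbb C^m: z_{i_1}=\dots=z_{i_k}=0\},$$ $$\mathcal Z(\Sigma)=\bigcup_{\sigma\in\Sigma}\{z\in\mathbb C^m: |z_j|\le 1\text{ for all }j,\ |z_j|=1\text{ if }j\notin g(\sigma)\}.$$ One has $\mathcal Z(\Sigma)\subset U(\Sigma)$; $U(\Sigma)$ is $(\mathbb C^* )^m$-invariant and $\mathcal Z(\Sigma)$ is $\mathbb T^m$-invariant. All spaces carry the topology induced from the Euclidean topology of $\mathbb C^m$, and orbit spaces carry the quotient topology. *)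

theory Defs
  imports "HOL-Analysis.Analysis"
begin

section \<open>Cones and fans\<close>

text \<open>A basis of the lattice \<open>N\<close> is fixed, so \<open>N\<close> is the type \<open>int ^ 'n\<close>, and
  \<open>N\<^sub>\<real>\<close> is \<open>real ^ 'n\<close>.\<close>

definition lattice_point :: "int ^ 'n \<Rightarrow> real ^ 'n" where
  "lattice_point a = (\<chi> k. real_of_int (a $ k))"

definition generated_cone :: "(int ^ 'n) set \<Rightarrow> (real ^ 'n) set" where
  "generated_cone A = {\<Sum>a\<in>A. \<mu> a *\<^sub>R lattice_point a |\<mu>. \<forall>a\<in>A. 0 \<le> \<mu> a}"

definition strongly_convex :: "(real ^ 'n) set \<Rightarrow> bool" where
  "strongly_convex \<sigma> \<longleftrightarrow> \<not> (\<exists>p v. v \<noteq> 0 \<and> (\<forall>t::real. p + t *\<^sub>R v \<in> \<sigma>))"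

definition polyhedral_cone :: "(real ^ 'n) set \<Rightarrow> bool" where
  "polyhedral_cone \<sigma> \<longleftrightarrow> (\<exists>A. finite A \<and> \<sigma> = generated_cone A) \<and> strongly_convex \<sigma>"

definition generator_set :: "(int ^ 'n) set \<Rightarrow> (real ^ 'n) set \<Rightarrow> bool" where
  "generator_set A \<sigma> \<longleftrightarrow>
     finite A \<and> \<sigma> = generated_cone A \<and> (\<forall>B. B \<subset> A \<longrightarrow> generated_cone B \<noteq> \<sigma>)"

definition simplicial_cone :: "(real ^ 'n) set \<Rightarrow> bool" where
  "simplicial_cone \<sigma> \<longleftrightarrow>
     (\<exists>A B. generator_set A \<sigma> \<and> lattice_point ` A \<subseteq> B \<and> independent B \<and> span B = UNIV)"

text \<open>The library's \<open>(face_of)\<close> also counts the empty set as a face of every convex set;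
  the faces of a cone are the nonempty ones.\<close>

definition cone_face :: "(real ^ 'n) set \<Rightarrow> (real ^ 'n) set \<Rightarrow> bool" where
  "cone_face \<tau> \<sigma> \<longleftrightarrow> \<tau> face_of \<sigma> \<and> \<tau> \<noteq> {}"

definition fan :: "(real ^ 'n) set set \<Rightarrow> bool" where
  "fan \<Sigma> \<longleftrightarrow>
     finite \<Sigma> \<and> \<Sigma> \<noteq> {} \<and>
     (\<forall>\<sigma>\<in>\<Sigma>. polyhedral_cone \<sigma>) \<and>
     (\<forall>\<sigma>\<in>\<Sigma>. \<forall>\<tau>. cone_face \<tau> \<sigma> \<longrightarrow> \<tau> \<in> \<Sigma>) \<and>
     (\<forall>\<sigma>\<in>\<Sigma>. \<forall>\<tau>\<in>\<Sigma>. cone_face (\<sigma> \<inter> \<tau>) \<sigma> \<and> cone_face (\<sigma> \<inter> \<tau>) \<tau>)"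

definition simplicial_fan :: "(real ^ 'n) set set \<Rightarrow> bool" where
  "simplicial_fan \<Sigma> \<longleftrightarrow> fan \<Sigma> \<and> (\<forall>\<sigma>\<in>\<Sigma>. simplicial_cone \<sigma>)"

definition complete_fan :: "(real ^ 'n) set set \<Rightarrow> bool" where
  "complete_fan \<Sigma> \<longleftrightarrow> fan \<Sigma> \<and> \<Union>\<Sigma> = UNIV"

definition rays :: "(real ^ 'n) set set \<Rightarrow> (real ^ 'n) set set" where
  "rays \<Sigma> = {\<rho> \<in> \<Sigma>. dim \<rho> = 1}"

definition primitive :: "int ^ 'n \<Rightarrow> bool" where
  "primitive a \<longleftrightarrow> a \<noteq> 0 \<and> (\<forall>k b. a = k *s b \<longrightarrow> \<bar>k\<bar> = 1)"

text \<open>The numbering of the rays by \<open>[m]\<close> is a bijection from a finite index type \<open>'m\<close>, which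
  forces \<open>m = CARD('m)\<close>; \<open>a i\<close> is the primitive generator of the \<open>i\<close>-th ray.\<close>

definition ray_generators :: "(real ^ 'n) set set \<Rightarrow> ('m \<Rightarrow> int ^ 'n) \<Rightarrow> bool" where
  "ray_generators \<Sigma> a \<longleftrightarrow>
     (\<forall>i. primitive (a i)) \<and> bij_betw (\<lambda>i. generated_cone {a i}) UNIV (rays \<Sigma>)"

definition cone_indices :: "('m \<Rightarrow> int ^ 'n) \<Rightarrow> (real ^ 'n) set \<Rightarrow> 'm set" where
  "cone_indices a \<sigma> = {i. cone_face (generated_cone {a i}) \<sigma>}"

definition g_subset :: "(real ^ 'n) set set \<Rightarrow> ('m \<Rightarrow> int ^ 'n) \<Rightarrow> 'm set \<Rightarrow> bool" where
  "g_subset \<Sigma> a I \<longleftrightarrow> (\<exists>\<sigma>\<in>\<Sigma>. I \<subseteq> cone_indices a \<sigma>)"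


section \<open>The spaces \<open>U(\<Sigma>)\<close> and \<open>Z(\<Sigma>)\<close> and the groups \<open>G\<close> and \<open>K\<close>\<close>

definition arrangement_complement ::
    "(real ^ 'n) set set \<Rightarrow> ('m::finite \<Rightarrow> int ^ 'n) \<Rightarrow> (complex ^ 'm) set" where
  "arrangement_complement \<Sigma> a =
     UNIV - \<Union> {{z. \<forall>i\<in>I. z $ i = 0} |I. \<not> g_subset \<Sigma> a I}"

definition moment_angle_complex ::
    "(real ^ 'n) set set \<Rightarrow> ('m::finite \<Rightarrow> int ^ 'n) \<Rightarrow> (complex ^ 'm) set" where
  "moment_angle_complex \<Sigma> a =
     (\<Union>\<sigma>\<in>\<Sigma>. {z. (\<forall>j. norm (z $ j) \<le> 1) \<and> (\<forall>j. j \<notin> cone_indices a \<sigma> \<longrightarrow> norm (z $ j) = 1)})"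

text \<open>Multiplication on \<open>complex ^ 'm\<close> is coordinatewise: it is the group operation of the tori
  below as well as their action on \<open>\<complex>\<^sup>m\<close>.\<close>

definition algebraic_torus :: "(complex ^ 'm) set" where
  "algebraic_torus = {t. \<forall>i. t $ i \<noteq> 0}"

definition compact_torus :: "(complex ^ 'm) set" where
  "compact_torus = {t. \<forall>i. norm (t $ i) = 1}"

text \<open>With \<open>N = \<int>\<^sup>n\<close>, the group \<open>N \<otimes> \<complex>\<^sup>*\<close> is \<open>(\<complex>\<^sup>*)\<^sup>n\<close>, where \<open>b \<otimes> s\<close> is the point with
  coordinates \<open>s powi b\<^sub>k\<close>.  The homomorphism induced by \<open>e\<^sub>i \<mapsto> a\<^sub>i\<close> sends \<open>t\<close> to the product of
  the points \<open>a\<^sub>i \<otimes> t\<^sub>i\<close>.  The same formula describes \<open>\<T>\<^sup>m \<rightarrow> N \<otimes> \<S>\<^sup>1\<close>.\<close>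

definition torus_hom :: "('m::finite \<Rightarrow> int ^ 'n) \<Rightarrow> complex ^ 'm \<Rightarrow> complex ^ 'n" where
  "torus_hom a t = (\<chi> k. \<Prod>i\<in>UNIV. (t $ i) powi (a i $ k))"

definition group_G :: "('m::finite \<Rightarrow> int ^ 'n) \<Rightarrow> (complex ^ 'm) set" where
  "group_G a = {t \<in> algebraic_torus. torus_hom a t = 1}"

definition group_K :: "('m::finite \<Rightarrow> int ^ 'n) \<Rightarrow> (complex ^ 'm) set" where
  "group_K a = {t \<in> compact_torus. torus_hom a t = 1}"


section \<open>Orbit spaces and equivariant deformation retractions\<close>

definition orbit :: "(complex ^ 'm) set \<Rightarrow> complex ^ 'm \<Rightarrow> (complex ^ 'm) set" where
  "orbit H z = {t * z |t. t \<in> H}"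

definition orbit_space :: "(complex ^ 'm) set \<Rightarrow> (complex ^ 'm) set \<Rightarrow> (complex ^ 'm) set topology"
  where
  "orbit_space H X =
     topology (\<lambda>V. V \<subseteq> orbit H ` X \<and> openin (top_of_set X) {x \<in> X. orbit H x \<in> V})"

lemma openin_orbit_space:
  "openin (orbit_space H X) V \<longleftrightarrow>
     V \<subseteq> orbit H ` X \<and> openin (top_of_set X) {x \<in> X. orbit H x \<in> V}"
proof -
  have "istopology (\<lambda>V. V \<subseteq> orbit H ` X \<and> openin (top_of_set X) {x \<in> X. orbit H x \<in> V})"
    unfolding istopology_def
  proof (intro conjI allI impI)
    fix S T
    assume S: "S \<subseteq> orbit H ` X \<and> openin (top_of_set X) {x \<in> X. orbit H x \<in> S}"
      and T: "T \<subseteq> orbit H ` X \<and> openin (top_of_set X) {x \<in> X. orbit H x \<in> T}"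
    have "{x \<in> X. orbit H x \<in> S \<inter> T} = {x \<in> X. orbit H x \<in> S} \<inter> {x \<in> X. orbit H x \<in> T}"
      by auto
    then show "openin (top_of_set X) {x \<in> X. orbit H x \<in> S \<inter> T}"
      using S T by (simp only: openin_Int)
    show "S \<inter> T \<subseteq> orbit H ` X" using S by auto
  next
    fix \<K>
    assume K: "\<forall>V\<in>\<K>. V \<subseteq> orbit H ` X \<and> openin (top_of_set X) {x \<in> X. orbit H x \<in> V}"
    have "{x \<in> X. orbit H x \<in> \<Union>\<K>} = (\<Union>V\<in>\<K>. {x \<in> X. orbit H x \<in> V})"
      by auto
    then show "openin (top_of_set X) {x \<in> X. orbit H x \<in> \<Union>\<K>}"
      using K by (simp only:) (rule openin_Union, blast)
    show "\<Union>\<K> \<subseteq> orbit H ` X" using K by auto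
  qed
  then show ?thesis
    by (simp add: orbit_space_def)
qed

lemma topspace_orbit_space: "topspace (orbit_space H X) = orbit H ` X"
proof
  show "topspace (orbit_space H X) \<subseteq> orbit H ` X"
    by (auto simp: topspace_def openin_orbit_space)
  have "{x \<in> X. orbit H x \<in> orbit H ` X} = X" by auto
  then have "openin (orbit_space H X) (orbit H ` X)"
    by (simp add: openin_orbit_space)
  then show "orbit H ` X \<subseteq> topspace (orbit_space H X)"
    by (rule openin_subset)
qed

lemma quotient_map_orbit: "quotient_map (top_of_set X) (orbit_space H X) (orbit H)"
  by (auto simp: quotient_map_def topspace_orbit_space openin_orbit_space)

definition equivariant_on ::
    "(complex ^ 'm) set \<Rightarrow> (complex ^ 'm) set \<Rightarrow> (complex ^ 'm \<Rightarrow> complex ^ 'm) \<Rightarrow> bool" where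
  "equivariant_on H X f \<longleftrightarrow> (\<forall>t\<in>H. \<forall>z\<in>X. f (t * z) = t * f z)"

text \<open>A deformation retraction is taken in the strong sense: every stage of the homotopy from the
  identity of \<open>X\<close> to the retraction \<open>r\<close> fixes \<open>Y\<close> pointwise.\<close>

definition equivariant_deformation_retraction ::
    "(complex ^ 'm) set \<Rightarrow> (complex ^ 'm::finite) set \<Rightarrow> (complex ^ 'm) set
      \<Rightarrow> (complex ^ 'm \<Rightarrow> complex ^ 'm) \<Rightarrow> bool" where
  "equivariant_deformation_retraction H X Y r \<longleftrightarrow>
     retraction X Y r \<and>
     homotopic_with_canon (\<lambda>f. equivariant_on H X f \<and> (\<forall>y\<in>Y. f y = y)) X X id r"

end

theory Submission
  imports Defs
begin

text \<open>
  Both parts rest on explicit radial rescalings.  For (b), the coordinate \<open>z\<^sub>i\<close> is divided by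
  \<open>max (s z) \<bar>z\<^sub>i\<bar>\<close>, where the threshold \<open>s z\<close> is the minimum of \<open>1\<close> and of all
  \<open>max\<^bsub>j\<in>J\<^esub> \<bar>z\<^sub>j\<bar>\<close> with \<open>J\<close> not a \<open>g\<close>-subset: the coordinates below the threshold then form a
  \<open>g\<close>-subset, and the others get modulus \<open>1\<close>.

  For (a), the logarithms of the moduli of an element of \<open>G\<close> form a linear relation between the ray
  generators, and in a simplicial fan a vector has at most one expression as a nonnegative
  combination of the generators of a cone.  Uniqueness of this expression shows that an element of
  \<open>G\<close> carrying a point of \<open>Z(\<Sigma>)\<close> into \<open>Z(\<Sigma>)\<close> lies in \<open>K\<close>, and, applied to limits of normalised
  logarithms, that \<open>G\<close> acts properly on \<open>U(\<Sigma>)\<close>, so that \<open>Z(\<Sigma>) \<rightarrow> U(\<Sigma>)/G\<close> is a closed map.  If the fan is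
  complete, every orbit in the open torus meets \<open>Z(\<Sigma>)\<close>, because the vector of negative logarithms lies
  in some cone; as the image of \<open>Z(\<Sigma>)\<close> is closed and the open torus is dense, all orbits do.
\<close>

section \<open>Coordinates in a simplicial fan\<close>

lemma generated_cone_zero: "0 \<in> generated_cone A"
  unfolding generated_cone_def by (rule CollectI, rule exI[of _ "\<lambda>_. 0"]) simp

lemma generated_cone_add:
  assumes "x \<in> generated_cone A" "y \<in> generated_cone A"
  shows "x + y \<in> generated_cone A"
proof -
  obtain \<mu> \<nu> where "x = (\<Sum>a\<in>A. \<mu> a *\<^sub>R lattice_point a)" "\<forall>a\<in>A. 0 \<le> \<mu> a"
      "y = (\<Sum>a\<in>A. \<nu> a *\<^sub>R lattice_point a)" "\<forall>a\<in>A. 0 \<le> \<nu> a"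
    using assms by (auto simp: generated_cone_def)
  then show ?thesis
    unfolding generated_cone_def
    by (intro CollectI exI[of _ "\<lambda>a. \<mu> a + \<nu> a"]) (simp add: scaleR_add_left sum.distrib)
qed

lemma generated_cone_scaleR:
  assumes "x \<in> generated_cone A" "0 \<le> c"
  shows "c *\<^sub>R x \<in> generated_cone A"
proof -
  obtain \<mu> where "x = (\<Sum>a\<in>A. \<mu> a *\<^sub>R lattice_point a)" "\<forall>a\<in>A. 0 \<le> \<mu> a"
    using assms by (auto simp: generated_cone_def)
  then show ?thesis
    unfolding generated_cone_def using \<open>0 \<le> c\<close>
    by (intro CollectI exI[of _ "\<lambda>a. c * \<mu> a"]) (simp add: scaleR_sum_right)
qed

lemma generated_cone_scaleR_cancel:
  assumes "c *\<^sub>R x \<in> generated_cone A" "0 < c"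
  shows "x \<in> generated_cone A"
  using generated_cone_scaleR[OF assms(1), of "1 / c"] assms(2) by simp

lemma generated_cone_sum:
  assumes "\<And>i. i \<in> I \<Longrightarrow> f i \<in> generated_cone A"
  shows "sum f I \<in> generated_cone A"
  using assms
  by (induction I rule: infinite_finite_induct)
    (auto intro: generated_cone_add generated_cone_zero)

lemma generated_cone_singleton: "generated_cone {b} = {c *\<^sub>R lattice_point b |c. 0 \<le> c}"
proof -
  have "\<exists>\<mu>. x = c *\<^sub>R x' \<longrightarrow> x = \<mu> b *\<^sub>R x' \<and> \<mu> b = c" for x x' :: "real ^ 'a" and c
    by (rule exI[of _ "\<lambda>_. c"]) simp
  then show ?thesis
    unfolding generated_cone_def by fastforce
qed

lemma generator_in_generated_cone:
  assumes "finite A" "b \<in> A"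
  shows "lattice_point b \<in> generated_cone A"
proof -
  have "(\<Sum>a\<in>A. (if a = b then 1 else 0) *\<^sub>R lattice_point a) = lattice_point b"
    using assms by (simp add: if_distrib[of "\<lambda>c. c *\<^sub>R _"] cong: if_cong)
  then show ?thesis
    unfolding generated_cone_def by (force intro!: exI[of _ "\<lambda>a. if a = b then 1 else 0"])
qed

lemma inj_lattice_point: "inj lattice_point"
  by (rule injI) (simp add: lattice_point_def vec_eq_iff)

lemma independent_lattice_pointsD:
  assumes "independent (lattice_point ` A)" "finite A"
    and "(\<Sum>a\<in>A. s a *\<^sub>R lattice_point a) = 0" "b \<in> A"
  shows "s b = 0"
proof -
  have inj: "inj_on lattice_point A"
    using inj_lattice_point by (rule inj_on_subset) simp
  have "(\<Sum>v\<in>lattice_point ` A. s (inv lattice_point v) *\<^sub>R v) = 0"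
    using assms(3) by (simp add: sum.reindex[OF inj] inv_f_f[OF inj_lattice_point])
  then have "s (inv lattice_point (lattice_point b)) = 0"
    using real_vector.independentD[OF assms(1), of "lattice_point ` A" "\<lambda>v. s (inv lattice_point v)"] assms(2,4)
    by auto
  then show ?thesis
    by (simp add: inv_f_f[OF inj_lattice_point])
qed

text \<open>The sum is the midpoint of \<open>2 *\<^sub>R x\<close> and
  \<open>2 *\<^sub>R y\<close>, so the face property applies to the doubled endpoints. The case
  \<open>x = y\<close> is separate because the open segment is then empty.\<close>

lemma face_of_generated_cone_addD:
  assumes "F face_of generated_cone A" "x \<in> generated_cone A" "y \<in> generated_cone A"
    and "x + y \<in> F"
  shows "2 *\<^sub>R x \<in> F"
proof (cases "x = y")
  case True
  then show ?thesis using assms(4) by (simp add: scaleR_2)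
next
  case False
  have "2 *\<^sub>R x \<in> generated_cone A" "2 *\<^sub>R y \<in> generated_cone A"
    using assms by (auto intro: generated_cone_scaleR)
  moreover have "x + y \<in> open_segment (2 *\<^sub>R x) (2 *\<^sub>R y)"
    unfolding in_segment using False by (auto intro!: exI[of _ "1/2"])
  ultimately show ?thesis
    using assms(1,4) unfolding face_of_def by blast
qed

text \<open>Coordinates with respect to an independent set are unique. If an interior point of a
  segment has only a \<open>b\<close>-coordinate, then the nonnegative coordinates of both endpoints
  at every other generator must vanish.\<close>

lemma ray_face_of_simplicial:
  assumes "finite A" "independent (lattice_point ` A)" "b \<in> A"
  shows "cone_face (generated_cone {b}) (generated_cone A)"
proof -
  have face: "x \<in> generated_cone {b}"
    if xy: "x \<in> generated_cone A" "y \<in> generated_cone A" "z \<in> generated_cone {b}"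
      and z: "z = (1 - t) *\<^sub>R x + t *\<^sub>R y" and t: "0 < t" "t < 1" for x y z t
  proof -
    obtain \<mu> \<nu> where x: "x = (\<Sum>a\<in>A. \<mu> a *\<^sub>R lattice_point a)" "\<forall>a\<in>A. 0 \<le> \<mu> a"
        and y: "y = (\<Sum>a\<in>A. \<nu> a *\<^sub>R lattice_point a)" "\<forall>a\<in>A. 0 \<le> \<nu> a"
      using xy by (auto simp: generated_cone_def)
    obtain c where c: "z = c *\<^sub>R lattice_point b"
      using xy(3) by (auto simp: generated_cone_singleton)
    have "c *\<^sub>R lattice_point b = (\<Sum>a\<in>A. (if a = b then c else 0) *\<^sub>R lattice_point a)"
      using assms by (simp add: if_distrib[of "\<lambda>c. c *\<^sub>R _"] cong: if_cong)
    then have "(\<Sum>a\<in>A. ((1 - t) * \<mu> a + t * \<nu> a - (if a = b then c else 0)) *\<^sub>R lattice_point a) = 0"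
      using z unfolding c x(1) y(1)
      by (simp add: algebra_simps sum.distrib sum_subtractf scaleR_sum_right)
    then have "(1 - t) * \<mu> a + t * \<nu> a = 0" if "a \<in> A" "a \<noteq> b" for a
      using independent_lattice_pointsD[OF assms(2,1) _ that(1)] that(2) by fastforce
    then have "\<mu> a = 0" if "a \<in> A" "a \<noteq> b" for a
      using that x(2) y(2) t
      by (smt (verit) mult_nonneg_nonneg mult_pos_pos)
    then have "x = (\<Sum>a\<in>A. if a = b then \<mu> b *\<^sub>R lattice_point b else 0)"
      unfolding x(1) by (intro sum.cong) auto
    also have "\<dots> = \<mu> b *\<^sub>R lattice_point b"
      using assms by simp
    finally show ?thesis
      using x(2) assms(3) by (auto simp: generated_cone_singleton)
  qed
  have "x \<in> generated_cone {b} \<and> y \<in> generated_cone {b}"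
    if xy: "x \<in> generated_cone A" "y \<in> generated_cone A" "z \<in> generated_cone {b}"
      "z \<in> open_segment x y" for x y z
  proof -
    obtain t where t: "z = (1 - t) *\<^sub>R x + t *\<^sub>R y" "0 < t" "t < 1"
      using xy(4) by (auto simp: in_segment)
    have "x \<in> generated_cone {b}"
      using face[OF xy(1-3) t] .
    moreover have "y \<in> generated_cone {b}"
      using face[OF xy(2,1,3), of "1 - t"] t by (simp add: add.commute)
    ultimately show ?thesis ..
  qed
  moreover have "generated_cone {b} \<subseteq> generated_cone A"
    using generator_in_generated_cone[OF assms(1,3)]
    by (auto simp: generated_cone_singleton intro: generated_cone_scaleR)
  moreover have "convex (generated_cone {b})"
    by (rule convexI) (intro generated_cone_add generated_cone_scaleR)
  moreover have "generated_cone {b} \<noteq> {}"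
    using generated_cone_zero by blast
  ultimately show ?thesis
    unfolding cone_face_def face_of_def by blast
qed

lemma dim_generated_cone_singleton:
  assumes "lattice_point b \<noteq> 0"
  shows "dim (generated_cone {b}) = 1"
proof -
  have "generated_cone {b} \<subseteq> span {lattice_point b}"
    by (auto simp: generated_cone_singleton intro: span_scale span_base)
  moreover have "{lattice_point b} \<subseteq> generated_cone {b}"
    using generator_in_generated_cone[of "{b}" b] by simp
  ultimately have "span (generated_cone {b}) = span {lattice_point b}"
    by (intro span_eq[THEN iffD2]) (auto intro: span_base)
  then have "dim (generated_cone {b}) = dim {lattice_point b}"
    by (metis dim_span)
  then show ?thesis
    using assms by (simp add: dim_singleton)
qed

section \<open>Cones of a simplicial fan in terms of the numbered ray generators\<close>

locale simplicial_fan_rays =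
  fixes \<Sigma> :: "(real ^ 'n::finite) set set" and a :: "'m::finite \<Rightarrow> int ^ 'n"
  assumes simplicial: "simplicial_fan \<Sigma>"
    and ray_gens: "ray_generators \<Sigma> a"
begin

abbreviation gen :: "'m \<Rightarrow> real ^ 'n" where "gen i \<equiv> lattice_point (a i)"

lemma gen_nonzero: "gen i \<noteq> 0"
proof -
  have "a i \<noteq> 0"
    using ray_gens by (auto simp: ray_generators_def primitive_def)
  then show ?thesis
    by (auto simp: lattice_point_def vec_eq_iff)
qed

lemma cone_eq_generated:
  assumes "\<sigma> \<in> \<Sigma>"
  obtains A where "finite A" "\<sigma> = generated_cone A" "independent (lattice_point ` A)"
proof -
  have "simplicial_cone \<sigma>"
    using assms simplicial by (auto simp: simplicial_fan_def)
  then obtain A B where "finite A" "\<sigma> = generated_cone A" "lattice_point ` A \<subseteq> B" "independent B"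
    unfolding simplicial_cone_def generator_set_def by blast
  then show thesis
    using that independent_mono by blast
qed

lemma fan_face: "\<lbrakk>\<sigma> \<in> \<Sigma>; cone_face \<tau> \<sigma>\<rbrakk> \<Longrightarrow> \<tau> \<in> \<Sigma>"
  using simplicial by (auto simp: simplicial_fan_def fan_def)

lemma fan_Int:
  assumes "\<sigma> \<in> \<Sigma>" "\<tau> \<in> \<Sigma>"
  shows "cone_face (\<sigma> \<inter> \<tau>) \<sigma>" "cone_face (\<sigma> \<inter> \<tau>) \<tau>"
  using assms simplicial by (auto simp: simplicial_fan_def fan_def)

lemma ray_in_fan: "generated_cone {a i} \<in> \<Sigma>"
  using ray_gens by (auto simp: ray_generators_def rays_def bij_betw_def)

lemma ray_inj: "generated_cone {a i} = generated_cone {a j} \<Longrightarrow> i = j"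
  using ray_gens by (auto simp: ray_generators_def bij_betw_def dest: injD)

lemma ray_surj:
  assumes "\<rho> \<in> \<Sigma>" "dim \<rho> = 1"
  obtains i where "\<rho> = generated_cone {a i}"
proof -
  have "\<rho> \<in> rays \<Sigma>" using assms by (simp add: rays_def)
  then have "\<rho> \<in> range (\<lambda>i. generated_cone {a i})"
    using ray_gens by (simp add: ray_generators_def bij_betw_def)
  then show thesis using that by blast
qed

text \<open>For the converse direction, the ray and \<open>\<sigma>\<close> both belong to the fan,
  so their intersection is a face of \<open>\<sigma>\<close>; once \<open>gen i\<close> lies in
  \<open>\<sigma>\<close> this intersection is the whole ray.\<close>

lemma cone_indices_iff:
  assumes "\<sigma> \<in> \<Sigma>"
  shows "i \<in> cone_indices a \<sigma> \<longleftrightarrow> gen i \<in> \<sigma>"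
proof
  assume "i \<in> cone_indices a \<sigma>"
  then have "generated_cone {a i} \<subseteq> \<sigma>"
    by (auto simp: cone_indices_def cone_face_def dest: face_of_imp_subset)
  then show "gen i \<in> \<sigma>"
    using generator_in_generated_cone[of "{a i}" "a i"] by auto
next
  assume i: "gen i \<in> \<sigma>"
  obtain A where "\<sigma> = generated_cone A"
    using assms by (rule cone_eq_generated)
  then have "generated_cone {a i} \<inter> \<sigma> = generated_cone {a i}"
    using i by (auto simp: generated_cone_singleton intro: generated_cone_scaleR)
  then show "i \<in> cone_indices a \<sigma>"
    using fan_Int(2)[OF ray_in_fan[of i] assms] by (simp add: cone_indices_def)
qed

text \<open>A generator of a simplicial cone spans a one-dimensional face, which belongs to the fan
  and is therefore one of the numbered rays. The generator itself may be non-primitive, hence the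
  factor \<open>c\<close>.\<close>

lemma generator_proportional:
  assumes "\<sigma> \<in> \<Sigma>" "finite A" "\<sigma> = generated_cone A" "independent (lattice_point ` A)" "b \<in> A"
  obtains i c where "i \<in> cone_indices a \<sigma>" "0 < c" "lattice_point b = c *\<^sub>R gen i"
    "generated_cone {b} = generated_cone {a i}"
proof -
  have nz: "lattice_point b \<noteq> 0"
    using assms(4,5) by (metis dependent_zero imageI)
  have "cone_face (generated_cone {b}) \<sigma>"
    using ray_face_of_simplicial[OF assms(2,4,5)] assms(3) by simp
  then obtain i where i: "generated_cone {b} = generated_cone {a i}"
    using ray_surj fan_face[OF assms(1)] dim_generated_cone_singleton[OF nz] by metis
  have "lattice_point b \<in> generated_cone {b}"
    by (simp add: generator_in_generated_cone)
  then obtain c where c: "0 \<le> c" "lattice_point b = c *\<^sub>R gen i"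
    unfolding i by (auto simp: generated_cone_singleton)
  moreover have "c \<noteq> 0" using nz c(2) by auto
  moreover have "i \<in> cone_indices a \<sigma>"
    using \<open>cone_face (generated_cone {b}) \<sigma>\<close> i by (simp add: cone_indices_def)
  ultimately show thesis
    using that[of i c] i by auto
qed

lemma cone_coordinates:
  assumes "\<sigma> \<in> \<Sigma>" "v \<in> \<sigma>"
  obtains w where "\<And>i. 0 \<le> w i" "\<And>i. i \<notin> cone_indices a \<sigma> \<Longrightarrow> w i = 0"
    "v = (\<Sum>i\<in>UNIV. w i *\<^sub>R gen i)"
proof -
  obtain A where A: "finite A" "\<sigma> = generated_cone A" "independent (lattice_point ` A)"
    using assms(1) by (rule cone_eq_generated)
  obtain \<mu> where \<mu>: "v = (\<Sum>b\<in>A. \<mu> b *\<^sub>R lattice_point b)" "\<forall>b\<in>A. 0 \<le> \<mu> b"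
    using assms(2) A(2) by (auto simp: generated_cone_def)
  have "\<forall>b\<in>A. \<exists>i c. i \<in> cone_indices a \<sigma> \<and> 0 < c \<and> lattice_point b = c *\<^sub>R gen i"
    using generator_proportional[OF assms(1) A] by metis
  then obtain f c where f: "\<And>b. b \<in> A \<Longrightarrow> f b \<in> cone_indices a \<sigma> \<and> 0 < c b \<and> lattice_point b = c b *\<^sub>R gen (f b)"
    by metis
  \<comment> \<open>Summing over the fibres of \<open>f\<close> gathers the contributions of all
    generators assigned to the same ray.\<close>
  define w where "w i = (\<Sum>b\<in>{b\<in>A. f b = i}. \<mu> b * c b)" for i
  have "v = (\<Sum>b\<in>A. (\<mu> b * c b) *\<^sub>R gen (f b))"
    unfolding \<mu>(1) using f by (intro sum.cong) auto
  also have "\<dots> = (\<Sum>i\<in>UNIV. \<Sum>b\<in>{b\<in>A. f b = i}. (\<mu> b * c b) *\<^sub>R gen (f b))"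
    by (rule sum.group[symmetric]) (use A in auto)
  also have "\<dots> = (\<Sum>i\<in>UNIV. w i *\<^sub>R gen i)"
    unfolding w_def scaleR_sum_left by (intro sum.cong) auto
  finally have "v = (\<Sum>i\<in>UNIV. w i *\<^sub>R gen i)" .
  moreover have "0 \<le> w i" for i
    unfolding w_def using f \<mu>(2) by (intro sum_nonneg) (simp add: less_imp_le)
  moreover have "w i = 0" if "i \<notin> cone_indices a \<sigma>" for i
    unfolding w_def using that f by (intro sum.neutral) auto
  ultimately show thesis using that by blast
qed

lemma cone_combination:
  assumes "\<sigma> \<in> \<Sigma>" "\<And>i. 0 \<le> w i" "\<And>i. i \<notin> cone_indices a \<sigma> \<Longrightarrow> w i = 0"
  shows "(\<Sum>i\<in>I. w i *\<^sub>R gen i) \<in> \<sigma>"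
proof -
  obtain A where A: "\<sigma> = generated_cone A"
    using assms(1) by (rule cone_eq_generated)
  have "w i *\<^sub>R gen i \<in> generated_cone A" for i
    using assms(2)[of i] assms(3)[of i] cone_indices_iff[OF assms(1), of i] A generated_cone_zero
    by (cases "i \<in> cone_indices a \<sigma>") (auto intro: generated_cone_scaleR)
  then show ?thesis
    unfolding A by (rule generated_cone_sum)
qed

text \<open>Each ray generator of \<open>\<sigma>\<close> is a positive multiple of an element of
  the independent set \<open>A\<close>, and different rays give different elements. A linear
  relation among the ray generators thus becomes one among elements of \<open>A\<close>.\<close>

lemma cone_generators_independent:
  assumes "\<sigma> \<in> \<Sigma>" "\<And>i. i \<notin> cone_indices a \<sigma> \<Longrightarrow> s i = 0"
    and "(\<Sum>i\<in>UNIV. s i *\<^sub>R gen i) = 0"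
  shows "s i = 0"
proof -
  obtain A where A: "finite A" "\<sigma> = generated_cone A" "independent (lattice_point ` A)"
    using assms(1) by (rule cone_eq_generated)
  have "\<exists>b\<in>A. \<exists>c. 0 < c \<and> gen i = c *\<^sub>R lattice_point b \<and> generated_cone {a i} = generated_cone {b}"
    if i: "i \<in> cone_indices a \<sigma>" for i
  proof -
    have face: "generated_cone {a i} face_of generated_cone A"
      using i A(2) by (auto simp: cone_indices_def cone_face_def)
    obtain \<mu> where \<mu>: "gen i = (\<Sum>b\<in>A. \<mu> b *\<^sub>R lattice_point b)" "\<forall>b\<in>A. 0 \<le> \<mu> b"
      using i cone_indices_iff[OF assms(1)] A(2) by (auto simp: generated_cone_def)
    \<comment> \<open>Since \<open>gen i\<close> is nonzero, some generator occurs in its expansion.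
      Splitting off this term and using that the ray is a face forces that generator into the
      ray.\<close>
    obtain b where b: "b \<in> A" "\<mu> b \<noteq> 0"
      using \<mu>(1) gen_nonzero[of i] by (cases "\<forall>b\<in>A. \<mu> b = 0") auto
    have split: "gen i = \<mu> b *\<^sub>R lattice_point b + (\<Sum>b'\<in>A - {b}. \<mu> b' *\<^sub>R lattice_point b')"
      unfolding \<mu>(1) using A(1) b(1) by (rule sum.remove)
    have "2 *\<^sub>R (\<mu> b *\<^sub>R lattice_point b) \<in> generated_cone {a i}"
    proof (rule face_of_generated_cone_addD[OF face])
      show "\<mu> b *\<^sub>R lattice_point b \<in> generated_cone A"
        using \<mu>(2) b(1) A(1) by (intro generated_cone_scaleR generator_in_generated_cone) auto
      show "(\<Sum>b'\<in>A - {b}. \<mu> b' *\<^sub>R lattice_point b') \<in> generated_cone A"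
        using \<mu>(2) A(1) by (intro generated_cone_sum generated_cone_scaleR generator_in_generated_cone) auto
      show "\<mu> b *\<^sub>R lattice_point b + (\<Sum>b'\<in>A - {b}. \<mu> b' *\<^sub>R lattice_point b') \<in> generated_cone {a i}"
        unfolding split[symmetric] by (simp add: generator_in_generated_cone)
    qed
    then have "(2 * \<mu> b) *\<^sub>R lattice_point b \<in> generated_cone {a i}"
      by simp
    then have "lattice_point b \<in> generated_cone {a i}"
      by (rule generated_cone_scaleR_cancel) (use \<mu>(2) b in \<open>auto simp: less_le\<close>)
    then obtain c where c: "0 \<le> c" "lattice_point b = c *\<^sub>R gen i"
      by (auto simp: generated_cone_singleton)
    have "lattice_point b \<noteq> 0"
      using A(3) b(1) by (metis dependent_zero imageI)
    then have "c \<noteq> 0" using c(2) by auto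
    have gi: "gen i = (1 / c) *\<^sub>R lattice_point b"
      using c \<open>c \<noteq> 0\<close> by simp
    have "generated_cone {a i} = generated_cone {b}"
    proof
      show "generated_cone {a i} \<subseteq> generated_cone {b}"
      proof
        fix x assume "x \<in> generated_cone {a i}"
        then obtain k where "0 \<le> k" "x = k *\<^sub>R gen i" by (auto simp: generated_cone_singleton)
        then show "x \<in> generated_cone {b}"
          unfolding gi using c(1) by (auto intro!: generated_cone_scaleR generator_in_generated_cone)
      qed
      show "generated_cone {b} \<subseteq> generated_cone {a i}"
        using \<open>lattice_point b \<in> generated_cone {a i}\<close>
        by (auto simp: generated_cone_singleton[of b] intro: generated_cone_scaleR)
    qed
    then show ?thesis
      using b(1) gi c(1) \<open>c \<noteq> 0\<close> by (auto intro!: bexI[of _ b] exI[of _ "1 / c"])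
  qed
  then obtain f c where f: "\<And>i. i \<in> cone_indices a \<sigma> \<Longrightarrow> f i \<in> A \<and> 0 < c i \<and>
      gen i = c i *\<^sub>R lattice_point (f i) \<and> generated_cone {a i} = generated_cone {f i}"
    by metis
  have inj: "inj_on f (cone_indices a \<sigma>)"
    by (rule inj_onI) (metis f ray_inj)
  define g where "g = the_inv_into (cone_indices a \<sigma>) f"
  have g: "g (f i) = i" if "i \<in> cone_indices a \<sigma>" for i
    unfolding g_def using inj that by (rule the_inv_into_f_f)
  have "0 = (\<Sum>i\<in>cone_indices a \<sigma>. s i *\<^sub>R gen i)"
    using assms(2,3) by (subst sum.mono_neutral_left[of UNIV]) auto
  also have "\<dots> = (\<Sum>i\<in>cone_indices a \<sigma>. (s (g (f i)) * c (g (f i))) *\<^sub>R lattice_point (f i))"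
    using f g by (intro sum.cong) auto
  also have "\<dots> = (\<Sum>b\<in>f ` cone_indices a \<sigma>. (s (g b) * c (g b)) *\<^sub>R lattice_point b)"
    by (simp add: sum.reindex[OF inj])
  finally have sum0: "(\<Sum>b\<in>f ` cone_indices a \<sigma>. (s (g b) * c (g b)) *\<^sub>R lattice_point b) = 0" ..
  have sub: "f ` cone_indices a \<sigma> \<subseteq> A" using f by auto
  have ind: "independent (lattice_point ` f ` cone_indices a \<sigma>)"
    using A(3) sub by (meson image_mono independent_mono)
  show ?thesis
  proof (cases "i \<in> cone_indices a \<sigma>")
    case True
    then have "s (g (f i)) * c (g (f i)) = 0"
      by (intro independent_lattice_pointsD[OF ind _ sum0]) auto
    then show ?thesis using True f g by fastforce
  qed (use assms(2) in auto)
qed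

text \<open>The common vector lies in \<open>\<sigma> \<inter> \<tau>\<close>, a face of
  \<open>\<sigma>\<close>, so every term of the \<open>p\<close>-sum with positive coefficient has
  its generator in \<open>\<tau>\<close>. Both expansions then use generators of
  \<open>\<tau>\<close> only, and these are independent.\<close>

lemma cone_coordinates_unique:
  assumes cones: "\<sigma> \<in> \<Sigma>" "\<tau> \<in> \<Sigma>"
    and p: "\<And>i. 0 \<le> p i" "\<And>i. i \<notin> cone_indices a \<sigma> \<Longrightarrow> p i = 0"
    and q: "\<And>i. 0 \<le> q i" "\<And>i. i \<notin> cone_indices a \<tau> \<Longrightarrow> q i = 0"
    and eq: "(\<Sum>i\<in>UNIV. p i *\<^sub>R gen i) = (\<Sum>i\<in>UNIV. q i *\<^sub>R gen i)"
  shows "p i = q i"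
proof -
  obtain A where A: "\<sigma> = generated_cone A"
    using cones(1) by (rule cone_eq_generated)
  obtain B where B: "\<tau> = generated_cone B"
    using cones(2) by (rule cone_eq_generated)
  have face: "\<sigma> \<inter> \<tau> face_of generated_cone A"
    using fan_Int(1)[OF cones] A by (simp add: cone_face_def)
  have v: "(\<Sum>i\<in>UNIV. p i *\<^sub>R gen i) \<in> \<sigma> \<inter> \<tau>"
    using cone_combination[where w=p and I=UNIV, OF cones(1) p]
      cone_combination[where w=q and I=UNIV, OF cones(2) q] eq by auto
  have supp: "p j = 0" if j: "j \<notin> cone_indices a \<tau>" for j
  proof (rule ccontr)
    assume "p j \<noteq> 0"
    then have pj: "0 < p j" "j \<in> cone_indices a \<sigma>" using p[of j] by (auto simp: less_le)
    have "2 *\<^sub>R (p j *\<^sub>R gen j) \<in> \<sigma> \<inter> \<tau>"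
    proof (rule face_of_generated_cone_addD[OF face])
      show "p j *\<^sub>R gen j \<in> generated_cone A"
        using pj cone_indices_iff[OF cones(1)] A by (auto intro: generated_cone_scaleR)
      show "(\<Sum>i\<in>UNIV - {j}. p i *\<^sub>R gen i) \<in> generated_cone A"
        using cone_combination[where w=p and I="UNIV - {j}", OF cones(1) p] A by simp
      show "p j *\<^sub>R gen j + (\<Sum>i\<in>UNIV - {j}. p i *\<^sub>R gen i) \<in> \<sigma> \<inter> \<tau>"
        using v by (simp add: sum.remove[of UNIV j])
    qed
    then have "(2 * p j) *\<^sub>R gen j \<in> generated_cone B"
      using B by simp
    then have "gen j \<in> \<tau>"
      unfolding B by (rule generated_cone_scaleR_cancel) (use pj(1) in simp)
    then show False using j cone_indices_iff[OF cones(2)] by simp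
  qed
  have "p i - q i = 0"
  proof (rule cone_generators_independent[OF cones(2), of "\<lambda>i. p i - q i"])
    show "(\<Sum>i\<in>UNIV. (p i - q i) *\<^sub>R gen i) = 0"
      using eq by (simp add: scaleR_diff_left sum_subtractf)
  qed (use supp q in auto)
  then show ?thesis by simp
qed

end

section \<open>The deformation retraction\<close>

text \<open>Subsets of \<open>g\<close>-subsets are \<open>g\<close>-subsets, so among all index
  sets on which \<open>z\<close> vanishes only the largest one has to be tested.\<close>

lemma mem_arrangement_complement:
  "z \<in> arrangement_complement \<Sigma> a \<longleftrightarrow> g_subset \<Sigma> a {i. z $ i = 0}"
proof -
  have "g_subset \<Sigma> a {i. z $ i = 0}" if "\<forall>I. \<not> g_subset \<Sigma> a I \<longrightarrow> (\<exists>i\<in>I. z $ i \<noteq> 0)"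
    using that[rule_format, of "{i. z $ i = 0}"] by auto
  moreover have "g_subset \<Sigma> a I" if "g_subset \<Sigma> a {i. z $ i = 0}" "\<forall>i\<in>I. z $ i = 0" for I
    using that unfolding g_subset_def by blast
  ultimately show ?thesis
    unfolding arrangement_complement_def by blast
qed

lemma mem_moment_angle_complex:
  "z \<in> moment_angle_complex \<Sigma> a \<longleftrightarrow>
     (\<forall>i. norm (z $ i) \<le> 1) \<and> g_subset \<Sigma> a {i. norm (z $ i) < 1}"
  unfolding moment_angle_complex_def g_subset_def
  by (auto simp: subset_iff less_le)

lemma moment_angle_complex_subset:
  "moment_angle_complex \<Sigma> a \<subseteq> arrangement_complement \<Sigma> a"
proof
  fix z assume "z \<in> moment_angle_complex \<Sigma> a"
  then have "g_subset \<Sigma> a {i. norm (z $ i) < 1}"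
    by (simp add: mem_moment_angle_complex)
  then show "z \<in> arrangement_complement \<Sigma> a"
    unfolding mem_arrangement_complement g_subset_def by force
qed

section \<open>The threshold function and its continuity\<close>

lemma continuous_on_Max_image:
  fixes f :: "'i \<Rightarrow> 'a::topological_space \<Rightarrow> real"
  assumes "finite I" "I \<noteq> {}" "\<And>i. i \<in> I \<Longrightarrow> continuous_on S (f i)"
  shows "continuous_on S (\<lambda>x. Max ((\<lambda>i. f i x) ` I))"
  using assms
proof (induction I rule: finite_ne_induct)
  case (insert i I)
  then have "Max ((\<lambda>i. f i x) ` insert i I) = max (f i x) (Max ((\<lambda>i. f i x) ` I))" for x
    by simp
  then show ?case using insert by (auto intro!: continuous_intros)
qed simp

lemma continuous_on_Min_image:
  fixes f :: "'i \<Rightarrow> 'a::topological_space \<Rightarrow> real"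
  assumes "finite I" "I \<noteq> {}" "\<And>i. i \<in> I \<Longrightarrow> continuous_on S (f i)"
  shows "continuous_on S (\<lambda>x. Min ((\<lambda>i. f i x) ` I))"
  using assms
proof (induction I rule: finite_ne_induct)
  case (insert i I)
  then have "Min ((\<lambda>i. f i x) ` insert i I) = min (f i x) (Min ((\<lambda>i. f i x) ` I))" for x
    by simp
  then show ?case using insert by (auto intro!: continuous_intros)
qed simp

text \<open>The inserted \<open>1\<close> also keeps the minimum meaningful when every index set is
  a \<open>g\<close>-subset.\<close>

definition threshold ::
    "(real ^ 'n) set set \<Rightarrow> ('m::finite \<Rightarrow> int ^ 'n) \<Rightarrow> complex ^ 'm \<Rightarrow> real" where
  "threshold \<Sigma> a z =
     Min (insert 1 ((\<lambda>J. Max ((\<lambda>j. norm (z $ j)) ` J)) ` {J. \<not> g_subset \<Sigma> a J}))"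

text \<open>The scalar interpolates linearly between \<open>1\<close> at time \<open>0\<close> and
  the full rescaling at time \<open>1\<close>. It is real and depends only on moduli, which gives
  equivariance under the compact torus.\<close>

definition shrink ::
    "(real ^ 'n) set set \<Rightarrow> ('m::finite \<Rightarrow> int ^ 'n) \<Rightarrow> real \<Rightarrow> complex ^ 'm \<Rightarrow> complex ^ 'm" where
  "shrink \<Sigma> a t z =
     (\<chi> i. complex_of_real (1 - t + t / max (threshold \<Sigma> a z) (norm (z $ i))) * z $ i)"

lemma non_g_subset_nonempty: "\<lbrakk>\<Sigma> \<noteq> {}; \<not> g_subset \<Sigma> a J\<rbrakk> \<Longrightarrow> J \<noteq> {}"
  unfolding g_subset_def by blast

lemma threshold_le_one: "threshold \<Sigma> a z \<le> 1"
  unfolding threshold_def by (rule Min_le) auto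

text \<open>As the fan is nonempty, the empty index set is a \<open>g\<close>-subset, so every
  maximum in the threshold is over a nonempty set.\<close>

lemma less_threshold_iff:
  fixes a :: "'m::finite \<Rightarrow> int ^ 'n"
  assumes "\<Sigma> \<noteq> {}"
  shows "c < threshold \<Sigma> a z \<longleftrightarrow> c < 1 \<and> (\<forall>J. \<not> g_subset \<Sigma> a J \<longrightarrow> (\<exists>j\<in>J. c < norm (z $ j)))"
  unfolding threshold_def using non_g_subset_nonempty[OF assms, of a]
  by (subst Min_gr_iff) (auto simp: Max_gr_iff)

text \<open>Otherwise this index set is itself one of the sets \<open>J\<close> in the threshold.
  Its largest modulus, attained and so below the threshold, would have to be at least the
  threshold.\<close>

lemma g_subset_below_threshold:
  fixes a :: "'m::finite \<Rightarrow> int ^ 'n"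
  assumes "\<Sigma> \<noteq> {}"
  shows "g_subset \<Sigma> a {i. norm (z $ i) < threshold \<Sigma> a z}"
proof (rule ccontr)
  assume J: "\<not> g_subset \<Sigma> a {i. norm (z $ i) < threshold \<Sigma> a z}" (is "\<not> g_subset \<Sigma> a ?J")
  define c where "c = Max ((\<lambda>j. norm (z $ j)) ` ?J)"
  have "c \<in> (\<lambda>j. norm (z $ j)) ` ?J"
    unfolding c_def using non_g_subset_nonempty[OF assms J] by (intro Max_in) auto
  then have "c < threshold \<Sigma> a z" by auto
  then obtain j where "j \<in> ?J" "c < norm (z $ j)"
    using J by (auto simp: less_threshold_iff[OF assms])
  moreover have "norm (z $ j) \<le> c" if "j \<in> ?J"
    unfolding c_def using that by (intro Max_ge) auto
  ultimately show False by simp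
qed

lemma threshold_pos:
  fixes a :: "'m::finite \<Rightarrow> int ^ 'n"
  assumes "\<Sigma> \<noteq> {}" "z \<in> arrangement_complement \<Sigma> a"
  shows "0 < threshold \<Sigma> a z"
  using assms(2) unfolding less_threshold_iff[OF assms(1)] arrangement_complement_def by auto

text \<open>The indices of modulus below \<open>1\<close> form a \<open>g\<close>-subset, so an
  index set that is not a \<open>g\<close>-subset contains a coordinate of modulus at least
  \<open>1\<close>. Hence every \<open>c < 1\<close> is below the threshold.\<close>

lemma threshold_eq_one:
  fixes a :: "'m::finite \<Rightarrow> int ^ 'n"
  assumes "\<Sigma> \<noteq> {}" "z \<in> moment_angle_complex \<Sigma> a"
  shows "threshold \<Sigma> a z = 1"
proof -
  have g: "g_subset \<Sigma> a {i. norm (z $ i) < 1}"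
    using assms(2) by (simp add: mem_moment_angle_complex)
  have "\<exists>j\<in>J. c < norm (z $ j)" if "c < 1" "\<not> g_subset \<Sigma> a J" for c J
  proof -
    have "\<not> J \<subseteq> {i. norm (z $ i) < 1}"
      using g that(2) unfolding g_subset_def by blast
    then show ?thesis using that(1) by force
  qed
  then have "c < threshold \<Sigma> a z" if "c < 1" for c
    using that by (simp add: less_threshold_iff[OF assms(1)])
  then show ?thesis
    using threshold_le_one[of \<Sigma> a z] by (meson less_irrefl not_le order_antisym)
qed

lemma continuous_on_threshold:
  fixes a :: "'m::finite \<Rightarrow> int ^ 'n"
  assumes "\<Sigma> \<noteq> {}"
  shows "continuous_on S (threshold \<Sigma> a)"
proof -
  let ?N = "{J. \<not> g_subset \<Sigma> a J}"
  have *: "continuous_on S (\<lambda>z::complex ^ 'm. Max ((\<lambda>j. norm (z $ j)) ` J))" if "J \<in> ?N" for J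
    using non_g_subset_nonempty[OF assms] that
    by (intro continuous_on_Max_image) (auto intro!: continuous_intros)
  show ?thesis
  proof (cases "?N = {}")
    case True
    then show ?thesis by (simp add: threshold_def[abs_def])
  next
    case False
    then have "threshold \<Sigma> a z = min 1 (Min ((\<lambda>J. Max ((\<lambda>j. norm (z $ j)) ` J)) ` ?N))" for z
      unfolding threshold_def by (intro Min_insert) auto
    moreover have "continuous_on S (\<lambda>z::complex ^ 'm. Min ((\<lambda>J. Max ((\<lambda>j. norm (z $ j)) ` J)) ` ?N))"
      using False * by (intro continuous_on_Min_image) auto
    ultimately show ?thesis by (auto intro!: continuous_intros)
  qed
qed

lemma threshold_torus:
  assumes "t \<in> compact_torus"
  shows "threshold \<Sigma> a (t * z) = threshold \<Sigma> a z"
  using assms by (simp add: threshold_def compact_torus_def norm_mult)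

section \<open>The radial rescaling and its equivariant homotopy\<close>

lemma shrink_scalar_pos:
  fixes a :: "'m::finite \<Rightarrow> int ^ 'n"
  assumes "\<Sigma> \<noteq> {}" "z \<in> arrangement_complement \<Sigma> a" "t \<in> {0..1}"
  shows "0 < 1 - t + t / max (threshold \<Sigma> a z) (norm (z $ i))"
\<comment> \<open>Positivity comes from \<open>1 - t\<close> before the final time and from the
  quotient at the final time.\<close>
proof (cases "t = 1")
  case False
  then show ?thesis
    using assms threshold_pos[OF assms(1,2)] by (intro add_pos_nonneg divide_nonneg_nonneg) auto
qed (use threshold_pos[OF assms(1,2)] in auto)

text \<open>Multiplying coordinates by positive scalars leaves the zero set unchanged, and
  membership depends on the zero set alone.\<close>

lemma shrink_in_complement:
  fixes a :: "'m::finite \<Rightarrow> int ^ 'n"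
  assumes "\<Sigma> \<noteq> {}" "z \<in> arrangement_complement \<Sigma> a" "t \<in> {0..1}"
  shows "shrink \<Sigma> a t z \<in> arrangement_complement \<Sigma> a"
proof -
  have "shrink \<Sigma> a t z $ i = 0 \<longleftrightarrow> z $ i = 0" for i
    using shrink_scalar_pos[OF assms, of i] unfolding shrink_def vec_lambda_beta
    by (simp only: mult_eq_0_iff of_real_eq_0_iff) linarith
  then show ?thesis
    using assms(2) by (simp add: mem_arrangement_complement)
qed

lemma shrink_one_in_complex:
  fixes a :: "'m::finite \<Rightarrow> int ^ 'n"
  assumes "\<Sigma> \<noteq> {}" "z \<in> arrangement_complement \<Sigma> a"
  shows "shrink \<Sigma> a 1 z \<in> moment_angle_complex \<Sigma> a"
proof -
  have norm: "norm (shrink \<Sigma> a 1 z $ i) = norm (z $ i) / max (threshold \<Sigma> a z) (norm (z $ i))" for i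
    using threshold_pos[OF assms] by (simp add: shrink_def norm_mult norm_divide)
  have "norm (shrink \<Sigma> a 1 z $ i) \<le> 1" for i
    unfolding norm using threshold_pos[OF assms] by (simp add: divide_le_eq)
  moreover have "norm (shrink \<Sigma> a 1 z $ i) < 1 \<longleftrightarrow> norm (z $ i) < threshold \<Sigma> a z" for i
    unfolding norm using threshold_pos[OF assms] by (auto simp: divide_less_eq max_def)
  ultimately show ?thesis
    using g_subset_below_threshold[OF assms(1), of a z] by (simp add: mem_moment_angle_complex)
qed

text \<open>On the complex the threshold is \<open>1\<close> and no modulus exceeds
  \<open>1\<close>, so the scalar is \<open>1 - t + t = 1\<close> at every stage.\<close>

lemma shrink_fixes:
  fixes a :: "'m::finite \<Rightarrow> int ^ 'n"
  assumes "\<Sigma> \<noteq> {}" "z \<in> moment_angle_complex \<Sigma> a"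
  shows "shrink \<Sigma> a t z = z"
  using assms(2) threshold_eq_one[OF assms]
  by (simp add: shrink_def vec_eq_iff mem_moment_angle_complex max_absorb1)

lemma shrink_zero: "shrink \<Sigma> a 0 z = z"
  by (simp add: shrink_def vec_eq_iff)

lemma shrink_torus:
  assumes "u \<in> compact_torus"
  shows "shrink \<Sigma> a t (u * z) = u * shrink \<Sigma> a t z"
  using assms threshold_torus[OF assms, of \<Sigma> a z]
  by (simp add: shrink_def vec_eq_iff norm_mult compact_torus_def)

lemma continuous_on_shrink:
  fixes a :: "'m::finite \<Rightarrow> int ^ 'n"
  assumes "\<Sigma> \<noteq> {}"
  shows "continuous_on ({0..1} \<times> arrangement_complement \<Sigma> a) (\<lambda>(t, z). shrink \<Sigma> a t z)"
proof -
  let ?S = "{0..1::real} \<times> arrangement_complement \<Sigma> a"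
  have thr: "continuous_on ?S (\<lambda>x. threshold \<Sigma> a (snd x))"
    by (rule continuous_on_compose2[OF continuous_on_threshold[OF assms, of UNIV] continuous_on_snd])
      (auto intro: continuous_on_id)
  have pos: "max (threshold \<Sigma> a (snd x)) (norm (snd x $ i)) \<noteq> 0" if "x \<in> ?S" for x i
    using threshold_pos[OF assms, of "snd x" a] that by auto
  show ?thesis
    unfolding shrink_def case_prod_unfold
    by (intro continuous_intros thr) (use pos in auto)
qed

lemma equivariant_deformation_retraction_shrink:
  fixes a :: "'m::finite \<Rightarrow> int ^ 'n"
  assumes "\<Sigma> \<noteq> {}"
  shows "equivariant_deformation_retraction compact_torus
           (arrangement_complement \<Sigma> a) (moment_angle_complex \<Sigma> a) (shrink \<Sigma> a 1)"
proof -
  let ?U = "arrangement_complement \<Sigma> a" and ?Z = "moment_angle_complex \<Sigma> a"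
  have "continuous_on ?U ((\<lambda>(t, z). shrink \<Sigma> a t z) \<circ> Pair 1)"
    by (rule continuous_on_o_Pair[OF continuous_on_shrink[OF assms]]) simp
  then have "continuous_on ?U (shrink \<Sigma> a 1)"
    by (simp add: o_def)
  then have "retraction ?U ?Z (shrink \<Sigma> a 1)"
    unfolding retraction_def
    using moment_angle_complex_subset[of \<Sigma> a] shrink_one_in_complex[OF assms, of _ a]
      shrink_fixes[OF assms, of _ a]
    by blast
  moreover have "homotopic_with_canon (\<lambda>f. equivariant_on compact_torus ?U f \<and> (\<forall>y\<in>?Z. f y = y))
      ?U ?U id (shrink \<Sigma> a 1)"
    unfolding homotopic_with_def
  proof (rule exI[of _ "\<lambda>(t, z). shrink \<Sigma> a t z"], intro conjI ballI allI)
    have "(\<lambda>(t, z). shrink \<Sigma> a t z) ` ({0..1::real} \<times> ?U) \<subseteq> ?U"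
    proof (rule image_subsetI)
      fix x :: "real \<times> (complex ^ 'm)" assume "x \<in> {0..1} \<times> ?U"
      then have "fst x \<in> {0..1}" "snd x \<in> ?U" by (simp_all add: mem_Times_iff)
      then show "(case x of (t, z) \<Rightarrow> shrink \<Sigma> a t z) \<in> ?U"
        unfolding case_prod_unfold by (intro shrink_in_complement[OF assms])
    qed
    then show "continuous_map (prod_topology (top_of_set {0..1}) (top_of_set ?U)) (top_of_set ?U)
        (\<lambda>(t, z). shrink \<Sigma> a t z)"
      using continuous_on_shrink[OF assms, of a]
      by (simp add: prod_topology_subtopology_eu image_subset_iff_funcset)
  next
    fix t :: real
    show "equivariant_on compact_torus ?U (\<lambda>z. case (t, z) of (t, z) \<Rightarrow> shrink \<Sigma> a t z)"
      by (simp add: equivariant_on_def shrink_torus)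
  qed (simp_all add: shrink_zero shrink_fixes[OF assms])
  ultimately show ?thesis
    unfolding equivariant_deformation_retraction_def ..
qed

section \<open>The action of \<open>G\<close>\<close>

lemma closedin_orbit_space:
  "closedin (orbit_space H X) C \<longleftrightarrow>
     C \<subseteq> orbit H ` X \<and> closedin (top_of_set X) {x \<in> X. orbit H x \<in> C}"
proof -
  have "{x \<in> X. orbit H x \<in> orbit H ` X - C} = X - {x \<in> X. orbit H x \<in> C}" by auto
  then show ?thesis
    unfolding closedin_def topspace_orbit_space openin_orbit_space by auto
qed

lemma torus_hom_mult: "torus_hom a (s * t) = torus_hom a s * torus_hom a t"
  by (simp add: torus_hom_def vec_eq_iff power_int_mult_distrib prod.distrib)

text \<open>This is the group inverse on \<open>algebraic_torus\<close>; the ambient ring is a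
  product of copies of the complex numbers, where only points without zero coordinates are
  invertible.\<close>

definition torus_inverse :: "complex ^ 'm::finite \<Rightarrow> complex ^ 'm" where
  "torus_inverse t = (\<chi> i. inverse (t $ i))"

lemma torus_inverse_mult: "t \<in> algebraic_torus \<Longrightarrow> torus_inverse t * t = 1"
  by (simp add: torus_inverse_def algebraic_torus_def vec_eq_iff)

lemma one_in_group_G: "1 \<in> group_G a"
  by (simp add: group_G_def algebraic_torus_def torus_hom_def vec_eq_iff)

lemma mult_in_group_G: "\<lbrakk>s \<in> group_G a; t \<in> group_G a\<rbrakk> \<Longrightarrow> s * t \<in> group_G a"
  by (simp add: group_G_def algebraic_torus_def torus_hom_mult)

lemma inverse_in_group_G:
  assumes "t \<in> group_G a"
  shows "torus_inverse t \<in> group_G a"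
proof -
  have t: "t \<in> algebraic_torus" "torus_hom a t = 1"
    using assms by (auto simp: group_G_def)
  have "torus_hom a (torus_inverse t) * torus_hom a t = 1"
    unfolding torus_hom_mult[symmetric] torus_inverse_mult[OF t(1)]
    using one_in_group_G[of a] by (simp add: group_G_def)
  then show ?thesis
    using t by (simp add: group_G_def algebraic_torus_def torus_inverse_def)
qed

lemma group_K_eq: "group_K a = group_G a \<inter> compact_torus"
  by (auto simp: group_K_def group_G_def compact_torus_def algebraic_torus_def)
    (metis norm_zero zero_neq_one)

lemma one_in_group_K: "1 \<in> group_K a"
  using one_in_group_G[of a] by (simp add: group_K_eq compact_torus_def)

lemma mult_in_group_K: "\<lbrakk>s \<in> group_K a; t \<in> group_K a\<rbrakk> \<Longrightarrow> s * t \<in> group_K a"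
  using mult_in_group_G[of s a t] by (simp add: group_K_eq compact_torus_def norm_mult)

lemma inverse_in_group_K: "t \<in> group_K a \<Longrightarrow> torus_inverse t \<in> group_K a"
  using inverse_in_group_G[of t a]
  by (simp add: group_K_eq compact_torus_def torus_inverse_def norm_inverse)

text \<open>The assumptions say that \<open>H\<close> is a subgroup of the torus; this form serves
  both \<open>group_G\<close> and \<open>group_K\<close>.\<close>

lemma orbit_eq_iff:
  assumes "1 \<in> H" "\<And>s t. \<lbrakk>s \<in> H; t \<in> H\<rbrakk> \<Longrightarrow> s * t \<in> H"
    and "\<And>t. t \<in> H \<Longrightarrow> torus_inverse t \<in> H" "H \<subseteq> algebraic_torus"
  shows "orbit H z = orbit H w \<longleftrightarrow> (\<exists>t\<in>H. w = t * z)"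
proof
  assume eq: "orbit H z = orbit H w"
  have "w \<in> orbit H w"
    unfolding orbit_def by (rule CollectI, rule exI[of _ 1]) (simp add: assms(1))
  then show "\<exists>t\<in>H. w = t * z"
    unfolding eq[symmetric] by (auto simp: orbit_def)
next
  assume "\<exists>t\<in>H. w = t * z"
  then obtain t where t: "t \<in> H" "w = t * z" by blast
  have "torus_inverse t * t = 1"
    using t(1) assms(4) by (intro torus_inverse_mult) auto
  then have "s * z = (s * torus_inverse t) * w" for s
    unfolding t(2) by (simp add: mult.assoc) (simp flip: mult.assoc)
  then have "orbit H z \<subseteq> orbit H w"
    unfolding orbit_def using assms(2,3) t(1) by blast
  moreover have "s * w = (s * t) * z" for s
    unfolding t(2) by (simp add: mult.assoc)
  then have "orbit H w \<subseteq> orbit H z"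
    unfolding orbit_def using assms(2) t(1) by blast
  ultimately show "orbit H z = orbit H w" by blast
qed

lemma orbit_G_eq_iff: "orbit (group_G a) z = orbit (group_G a) w \<longleftrightarrow> (\<exists>t\<in>group_G a. w = t * z)"
  by (rule orbit_eq_iff)
    (auto simp: one_in_group_G mult_in_group_G inverse_in_group_G, simp add: group_G_def)

lemma orbit_K_eq_iff: "orbit (group_K a) z = orbit (group_K a) w \<longleftrightarrow> (\<exists>t\<in>group_K a. w = t * z)"
  by (rule orbit_eq_iff)
    (auto simp: one_in_group_K mult_in_group_K inverse_in_group_K, simp add: group_K_eq group_G_def)

section \<open>Logarithms of moduli, and limits in \<open>G\<close>\<close>

lemma prod_powi_eq_exp:
  fixes x :: "'i \<Rightarrow> real"
  assumes "finite I"
  shows "(\<Prod>i\<in>I. exp (x i) powi k i) = exp (\<Sum>i\<in>I. real_of_int (k i) * x i)"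
  using assms by (simp add: exp_sum exp_power_int)

text \<open>Taking moduli in the equation \<open>torus_hom a t = 1\<close> turns each coordinate
  into a product of positive reals equal to \<open>1\<close>, whose logarithm is one coordinate of
  the relation.\<close>

lemma group_G_log_relation:
  assumes "t \<in> group_G a"
  shows "(\<Sum>i\<in>UNIV. ln (norm (t $ i)) *\<^sub>R lattice_point (a i)) = 0"
proof -
  have "(\<Sum>i\<in>UNIV. ln (norm (t $ i)) * real_of_int (a i $ k)) = 0" for k
  proof -
    have "exp (\<Sum>i\<in>UNIV. real_of_int (a i $ k) * ln (norm (t $ i))) =
        (\<Prod>i\<in>UNIV. exp (ln (norm (t $ i))) powi (a i $ k))"
      by (simp add: prod_powi_eq_exp)
    also have "\<dots> = norm (torus_hom a t $ k)"
      unfolding torus_hom_def using assms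
      by (simp add: group_G_def algebraic_torus_def norm_power_int flip: prod_norm)
    also have "\<dots> = 1"
      using assms by (simp add: group_G_def)
    finally show ?thesis by (simp add: mult.commute)
  qed
  then show ?thesis
    by (simp add: vec_eq_iff lattice_point_def)
qed

lemma exp_in_group_G:
  assumes "(\<Sum>i\<in>UNIV. u i *\<^sub>R lattice_point (a i)) = 0"
  shows "(\<chi> i. complex_of_real (exp (u i))) \<in> group_G a"
proof -
  have "(\<Sum>i\<in>UNIV. real_of_int (a i $ k) * u i) = 0" for k
    using assms by (simp add: vec_eq_iff lattice_point_def mult.commute)
  then have "(\<Prod>i\<in>UNIV. exp (u i) powi (a i $ k)) = 1" for k
    by (simp add: prod_powi_eq_exp)
  then have "(\<Prod>i\<in>UNIV. complex_of_real (exp (u i)) powi (a i $ k)) = 1" for k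
    by (metis (no_types, lifting) of_real_1 of_real_power_int of_real_prod prod.cong)
  then show ?thesis
    by (simp add: group_G_def algebraic_torus_def torus_hom_def vec_eq_iff)
qed

lemma tendsto_vec_mult:
  fixes f g :: "'b \<Rightarrow> complex ^ 'm::finite"
  assumes "(f \<longlongrightarrow> x) F" "(g \<longlongrightarrow> y) F"
  shows "((\<lambda>n. f n * g n) \<longlongrightarrow> x * y) F"
  by (rule vec_tendstoI) (simp, intro tendsto_intros assms)

text \<open>The exponents may be negative, so \<open>torus_hom a\<close> is continuous only where no
  coordinate vanishes; hence the condition that the limit lies in the torus.\<close>

lemma group_G_closed_in_torus:
  assumes "\<And>n. t n \<in> group_G a" "t \<longlonglongrightarrow> l" "l \<in> algebraic_torus"
  shows "l \<in> group_G a"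
proof -
  have nz: "l $ i \<noteq> 0" for i
    using assms(3) by (simp add: algebraic_torus_def)
  have "(\<lambda>n. torus_hom a (t n)) \<longlonglongrightarrow> torus_hom a l"
    unfolding torus_hom_def by (intro tendsto_intros assms(2) nz)
  moreover have "torus_hom a (t n) = 1" for n
    using assms(1) by (simp add: group_G_def)
  ultimately have "torus_hom a l = 1"
    by (simp add: LIMSEQ_const_iff)
  then show ?thesis
    using assms(3) by (simp add: group_G_def)
qed

text \<open>The factor \<open>exp (u n)\<close> is eventually a quotient converging to
  \<open>y / x\<close>. Only an upper bound results, since \<open>y\<close> may be zero.\<close>

lemma exponent_eventually_bounded:
  fixes u g :: "nat \<Rightarrow> real"
  assumes "(\<lambda>n. exp (u n) * g n) \<longlonglongrightarrow> y" "g \<longlonglongrightarrow> x" "x \<noteq> 0"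
  shows "\<exists>B. \<forall>\<^sub>F n in sequentially. u n \<le> B"
proof -
  have "(\<lambda>n. exp (u n) * g n / g n) \<longlonglongrightarrow> y / x"
    using assms by (rule tendsto_divide)
  moreover have "\<forall>\<^sub>F n in sequentially. g n \<noteq> 0"
    using assms(2,3) by (rule tendsto_imp_eventually_ne)
  ultimately have "(\<lambda>n. exp (u n)) \<longlonglongrightarrow> y / x"
    by (rule Lim_transform_eventually[OF _ eventually_mono]) simp
  then have "\<forall>\<^sub>F n in sequentially. exp (u n) < y / x + 1"
    by (rule order_tendstoD(2)) simp
  then have "\<forall>\<^sub>F n in sequentially. u n \<le> ln (y / x + 1)"
  proof (rule eventually_mono)
    fix n assume "exp (u n) < y / x + 1"
    then show "u n \<le> ln (y / x + 1)"
      using ln_ge_iff[of "y / x + 1" "u n"] exp_gt_zero[of "u n"] by linarith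
  qed
  then show ?thesis ..
qed

section \<open>Returns to the complex, properness, and orbits through the open torus\<close>

context simplicial_fan_rays
begin

abbreviation "\<U> \<equiv> arrangement_complement \<Sigma> a"
abbreviation "\<Z> \<equiv> moment_angle_complex \<Sigma> a"

lemma finite_fan: "finite \<Sigma>" and fan_nonempty: "\<Sigma> \<noteq> {}"
  using simplicial by (auto simp: simplicial_fan_def fan_def)

lemma compact_complex: "compact \<Z>"
proof -
  have "closed \<Z>"
    unfolding moment_angle_complex_def
    by (intro closed_UN finite_fan ballI closed_Collect_conj closed_Collect_all closed_Collect_imp
        closed_Collect_le closed_Collect_eq continuous_intros) simp
  moreover have "norm z \<le> real CARD('m)" if "z \<in> \<Z>" for z
  proof -
    have "norm z \<le> (\<Sum>i\<in>UNIV. norm (z $ i))" by (simp add: norm_vec_def L2_set_le_sum)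
    also have "\<dots> \<le> (\<Sum>i\<in>(UNIV :: 'm set). 1)"
      using that by (intro sum_mono) (simp add: mem_moment_angle_complex)
    finally show ?thesis by simp
  qed
  then have "bounded \<Z>" by (auto simp: bounded_iff)
  ultimately show ?thesis by (simp add: compact_eq_bounded_closed)
qed

text \<open>The negative logarithms of the moduli of \<open>z\<close> and of \<open>t * z\<close>
  are nonnegative, supported on cones of the fan, and differ by a linear relation \<open>u\<close>.
  By uniqueness of coordinates \<open>u\<close> vanishes, so \<open>t\<close> has moduli
  \<open>1\<close>.\<close>

lemma group_G_meets_complex_in_K:
  assumes "z \<in> \<Z>" "t \<in> group_G a" "t * z \<in> \<Z>"
  shows "t \<in> group_K a"
proof -
  obtain \<sigma> where \<sigma>: "\<sigma> \<in> \<Sigma>" "{i. norm (z $ i) < 1} \<subseteq> cone_indices a \<sigma>"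
    using assms(1) by (auto simp: mem_moment_angle_complex g_subset_def)
  obtain \<tau> where \<tau>: "\<tau> \<in> \<Sigma>" "{i. norm ((t * z) $ i) < 1} \<subseteq> cone_indices a \<tau>"
    using assms(3) by (auto simp: mem_moment_angle_complex g_subset_def)
  have t: "t $ i \<noteq> 0" for i
    using assms(2) by (simp add: group_G_def algebraic_torus_def)
  define u where "u i = ln (norm (t $ i))" for i
  define C where "C = (\<Sum>i\<in>UNIV. \<bar>u i\<bar>)"
  have C: "\<bar>u i\<bar> \<le> C" for i
    unfolding C_def by (rule member_le_sum) auto
  \<comment> \<open>Zero coordinates have infinite negative logarithm; any constant large enough to absorb \<open>u\<close>
    can stand for it, since \<open>z\<close> and \<open>t * z\<close> vanish at the same indices.\<close>
  define p where "p i = (if z $ i = 0 then C else - ln (norm (z $ i)))" for i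
  have le1: "norm (z $ i) \<le> 1" "norm (t $ i) * norm (z $ i) \<le> 1" for i
    using assms(1,3) by (auto simp: mem_moment_angle_complex norm_mult)
  have q: "p i - u i = (if z $ i = 0 then C - u i else - ln (norm ((t * z) $ i)))" for i
    using t[of i] by (simp add: p_def u_def norm_mult ln_mult)
  have "p i = p i - u i" for i
  proof (rule cone_coordinates_unique[OF \<sigma>(1) \<tau>(1), of p "\<lambda>i. p i - u i"])
    show "0 \<le> p i" for i
      using le1(1)[of i] C[of i] by (auto simp: p_def ln_le_zero_iff)
    show "p i = 0" if "i \<notin> cone_indices a \<sigma>" for i
    proof -
      have "norm (z $ i) = 1" using that \<sigma>(2) le1(1)[of i] by force
      then show ?thesis by (auto simp: p_def)
    qed
    show "0 \<le> p i - u i" for i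
      unfolding q using le1(2)[of i] C[of i] t[of i] by (auto simp: norm_mult ln_le_zero_iff)
    show "p i - u i = 0" if "i \<notin> cone_indices a \<tau>" for i
    proof -
      have "norm ((t * z) $ i) = 1" using that \<tau>(2) le1(2)[of i] by (force simp: norm_mult)
      then show ?thesis unfolding q by auto
    qed
    show "(\<Sum>i\<in>UNIV. p i *\<^sub>R gen i) = (\<Sum>i\<in>UNIV. (p i - u i) *\<^sub>R gen i)"
      using group_G_log_relation[OF assms(2)]
      by (simp add: scaleR_diff_left sum_subtractf u_def)
  qed
  then have "u i = 0" for i by (simp add: eq_diff_eq)
  then have "norm (t $ i) = 1" for i
    using t[of i] unfolding u_def by (metis exp_ln exp_zero zero_less_norm_iff)
  then show ?thesis
    using assms(2) by (simp add: group_K_eq compact_torus_def)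
qed

text \<open>This is properness in sequential form. Once the logarithms of the moduli of
  \<open>t n\<close> are bounded, a subsequence of \<open>t\<close> converges inside the torus, and
  its limit carries \<open>x\<close> to \<open>y\<close>.\<close>

lemma group_G_proper:
  assumes z: "z \<longlonglongrightarrow> x" "x \<in> \<U>"
    and t: "\<And>n. t n \<in> group_G a"
    and tz: "(\<lambda>n. t n * z n) \<longlonglongrightarrow> y" "y \<in> \<U>"
  shows "\<exists>s\<in>group_G a. y = s * x"
proof -
  have t0: "t n $ i \<noteq> 0" for n i
    using t[of n] by (simp add: group_G_def algebraic_torus_def)
  define u :: "nat \<Rightarrow> real ^ 'm" where "u n = (\<chi> i. ln (norm (t n $ i)))" for n
  have rel: "(\<Sum>i\<in>UNIV. (u n $ i) *\<^sub>R gen i) = 0" for n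
    using group_G_log_relation[OF t[of n]] by (simp add: u_def)
  have expu: "exp (u n $ i) = norm (t n $ i)" for n i
    using t0[of n i] by (simp add: u_def)
  have zi: "(\<lambda>n. norm (z n $ i)) \<longlonglongrightarrow> norm (x $ i)" for i
    by (intro tendsto_intros z)
  have tzi: "(\<lambda>n. exp (u n $ i) * norm (z n $ i)) \<longlonglongrightarrow> norm (y $ i)" for i
    using tendsto_norm[OF tendsto_vec_nth[OF tz(1), of i]] by (simp add: norm_mult expu)
  have upper: "\<exists>B. \<forall>\<^sub>F n in sequentially. u n $ i \<le> B" if "x $ i \<noteq> 0" for i
    by (rule exponent_eventually_bounded[OF tzi zi]) (use that in simp)
  \<comment> \<open>The roles of the two sequences are exchanged: the inverse factor carries the
    moduli of \<open>t n * z n\<close> back to those of \<open>z n\<close>.\<close>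
  have lower: "\<exists>B. \<forall>\<^sub>F n in sequentially. - u n $ i \<le> B" if "y $ i \<noteq> 0" for i
  proof (rule exponent_eventually_bounded[OF _ tzi])
    show "(\<lambda>n. exp (- u n $ i) * (exp (u n $ i) * norm (z n $ i))) \<longlonglongrightarrow> norm (x $ i)"
      using zi[of i] by (simp add: exp_minus flip: mult.assoc)
  qed (use that in simp)
  have "bounded (range u)"
  proof (rule ccontr)
    assume unb: "\<not> bounded (range u)"
    \<comment> \<open>The extra condition \<open>n \<ge> N\<close> makes the chosen indices tend to
      infinity, so eventual bounds on \<open>u\<close> survive along them.\<close>
    have "\<exists>n\<ge>N. real N < norm (u n)" for N
    proof (rule ccontr)
      assume "\<not> (\<exists>n\<ge>N. real N < norm (u n))"
      then have "bounded (u ` {N..})"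
        by (auto simp: bounded_iff not_less)
      then have "bounded (u ` {..<N} \<union> u ` {N..})"
        by (simp add: finite_imp_bounded)
      moreover have "{..<N} \<union> {N..} = UNIV" by auto
      ultimately show False
        using unb by (simp flip: image_Un)
    qed
    then obtain r where r: "\<And>N. N \<le> r N" "\<And>N. real N < norm (u (r N))"
      by metis
    \<comment> \<open>The positive part of the limiting direction is supported on the zeros of \<open>x\<close>, the negative
      part on the zeros of \<open>y\<close>; both index sets span cones of the fan.\<close>
    define v where "v N = (1 / norm (u (r N))) *\<^sub>R u (r N)" for N
    have "norm (v N) = 1" for N
      using r(2)[of N] by (auto simp: v_def)
    then have "\<forall>N. v N \<in> sphere 0 1" by simp
    moreover have "seq_compact (sphere (0 :: real ^ 'm) 1)"
      by (simp add: compact_imp_seq_compact)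
    ultimately obtain l s where l: "l \<in> sphere 0 1" and s: "strict_mono s" and lim: "(v \<circ> s) \<longlonglongrightarrow> l"
      using seq_compactE by metis
    have s_ge: "N \<le> s N" for N by (rule strict_mono_imp_increasing[OF s])
    have r_s: "filterlim (\<lambda>N. r (s N)) sequentially sequentially"
      by (rule filterlim_at_top_mono[OF filterlim_ident]) (use r(1) s_ge order_trans in \<open>blast intro: always_eventually\<close>)
    have v_le: "c * v (s N) $ i \<le> \<bar>b\<bar> / real N"
      if "c * u (r (s N)) $ i \<le> b" "0 < N" for c b i N
    proof -
      have N: "real N \<le> norm (u (r (s N)))"
        using r(2)[of "s N"] s_ge[of N] by linarith
      have "c * v (s N) $ i = (c * u (r (s N)) $ i) / norm (u (r (s N)))"
        by (simp add: v_def)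
      also have "\<dots> \<le> \<bar>b\<bar> / norm (u (r (s N)))"
        using that(1) by (intro divide_right_mono) auto
      also have "\<dots> \<le> \<bar>b\<bar> / real N"
        using N that(2) by (intro frac_le) auto
      finally show ?thesis .
    qed
    \<comment> \<open>A one-sided bound on a coordinate of \<open>u\<close> becomes negligible after
      division by norms tending to infinity. The values \<open>c = 1\<close> and
      \<open>c = -1\<close> give the two signs.\<close>
    have l_le: "c * l $ i \<le> 0" if "\<forall>\<^sub>F n in sequentially. c * u n $ i \<le> b" for c b i
    proof (rule tendsto_le[OF sequentially_bot])
      show "(\<lambda>N. \<bar>b\<bar> / real N) \<longlonglongrightarrow> 0" by (rule lim_const_over_n)
      show "(\<lambda>N. c * v (s N) $ i) \<longlonglongrightarrow> c * l $ i"
        using lim by (intro tendsto_intros) (simp add: o_def)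
      show "\<forall>\<^sub>F N in sequentially. c * v (s N) $ i \<le> \<bar>b\<bar> / real N"
        using eventually_compose_filterlim[OF that r_s] eventually_gt_at_top[of 0]
        by eventually_elim (rule v_le)
    qed
    have l_nonpos: "l $ i \<le> 0" if "x $ i \<noteq> 0" for i
      using upper[OF that] l_le[of 1 i] by auto
    have l_nonneg: "0 \<le> l $ i" if "y $ i \<noteq> 0" for i
      using lower[OF that] l_le[of "-1" i] by auto
    have "(\<lambda>N. \<Sum>i\<in>UNIV. v (s N) $ i *\<^sub>R gen i) \<longlonglongrightarrow> (\<Sum>i\<in>UNIV. l $ i *\<^sub>R gen i)"
      using lim by (intro tendsto_intros) (simp add: o_def)
    moreover have "(\<Sum>i\<in>UNIV. v (s N) $ i *\<^sub>R gen i) = 0" for N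
    proof -
      have "(\<Sum>i\<in>UNIV. v (s N) $ i *\<^sub>R gen i) =
          (1 / norm (u (r (s N)))) *\<^sub>R (\<Sum>i\<in>UNIV. u (r (s N)) $ i *\<^sub>R gen i)"
        by (simp add: v_def scaleR_sum_right)
      then show ?thesis by (simp add: rel)
    qed
    ultimately have l_rel: "(\<Sum>i\<in>UNIV. l $ i *\<^sub>R gen i) = 0"
      by (simp add: LIMSEQ_const_iff)
    obtain \<sigma> where \<sigma>: "\<sigma> \<in> \<Sigma>" "{i. x $ i = 0} \<subseteq> cone_indices a \<sigma>"
      using z(2) by (auto simp: mem_arrangement_complement g_subset_def)
    obtain \<tau> where \<tau>: "\<tau> \<in> \<Sigma>" "{i. y $ i = 0} \<subseteq> cone_indices a \<tau>"
      using tz(2) by (auto simp: mem_arrangement_complement g_subset_def)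
    \<comment> \<open>The relation for \<open>l\<close> says that its positive and negative parts
      represent the same vector, so they agree. A real number with equal positive and negative parts
      is zero, against \<open>l\<close> having norm \<open>1\<close>.\<close>
    have max_eq: "max (l $ i) 0 = max (- l $ i) 0" for i
    proof (rule cone_coordinates_unique[OF \<sigma>(1) \<tau>(1), where p="\<lambda>i. max (l $ i) 0" and q="\<lambda>i. max (- l $ i) 0"])
      show "max (l $ i) 0 = 0" if "i \<notin> cone_indices a \<sigma>" for i
      proof -
        have "x $ i \<noteq> 0" using that \<sigma>(2) by auto
        then show ?thesis using l_nonpos[of i] by simp
      qed
      show "max (- l $ i) 0 = 0" if "i \<notin> cone_indices a \<tau>" for i
      proof -
        have "y $ i \<noteq> 0" using that \<tau>(2) by auto
        then show ?thesis using l_nonneg[of i] by simp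
      qed
      have "(\<Sum>i\<in>UNIV. max (l $ i) 0 *\<^sub>R gen i) - (\<Sum>i\<in>UNIV. max (- l $ i) 0 *\<^sub>R gen i) =
          (\<Sum>i\<in>UNIV. l $ i *\<^sub>R gen i)"
        unfolding sum_subtractf[symmetric] scaleR_diff_left[symmetric]
        by (intro sum.cong) (auto simp: max_def)
      then show "(\<Sum>i\<in>UNIV. max (l $ i) 0 *\<^sub>R gen i) = (\<Sum>i\<in>UNIV. max (- l $ i) 0 *\<^sub>R gen i)"
        using l_rel by simp
    qed auto
    have "l $ i = 0" for i
      using max_eq[of i] by linarith
    then have "l = 0" by (simp add: vec_eq_iff)
    then show False using l by simp
  qed
  then obtain B where B: "\<And>n. norm (u n) \<le> B"
    by (auto simp: bounded_iff)
  have u_le: "\<bar>u n $ i\<bar> \<le> B" for n i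
    using B[of n] component_le_norm_cart[of "u n" i] by linarith
  have "norm (t n) \<le> real CARD('m) * exp B" for n
  proof -
    have "norm (t n) \<le> (\<Sum>i\<in>UNIV. norm (t n $ i))"
      by (simp add: norm_vec_def L2_set_le_sum)
    also have "\<dots> \<le> (\<Sum>i\<in>(UNIV :: 'm set). exp B)"
      using u_le by (intro sum_mono) (simp add: abs_le_iff flip: expu)
    finally show ?thesis by simp
  qed
  then have "bounded (range t)" by (auto simp: bounded_iff)
  then obtain s r where s: "strict_mono (r :: nat \<Rightarrow> nat)" "(t \<circ> r) \<longlonglongrightarrow> s"
    using bounded_imp_convergent_subsequence[of t] by auto
  \<comment> \<open>The bound on \<open>u\<close> keeps all moduli at least
    \<open>exp (- B)\<close>, so the limit cannot leave the torus.\<close>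
  have "s $ i \<noteq> 0" for i
  proof -
    have "(\<lambda>n. norm (t (r n) $ i)) \<longlonglongrightarrow> norm (s $ i)"
      using s(2) by (intro tendsto_intros) (simp add: o_def)
    moreover have "exp (- B) \<le> norm (t (r n) $ i)" for n
      using u_le[of "r n" i] by (simp flip: expu)
    ultimately have "exp (- B) \<le> norm (s $ i)"
      by (intro LIMSEQ_le_const) auto
    then show ?thesis by (metis exp_gt_zero norm_zero not_le)
  qed
  then have "s \<in> algebraic_torus" by (simp add: algebraic_torus_def)
  then have "s \<in> group_G a"
    using group_G_closed_in_torus[OF _ s(2), of a] t by simp
  moreover have "(\<lambda>n. t (r n) * z (r n)) \<longlonglongrightarrow> s * x"
    using s LIMSEQ_subseq_LIMSEQ[OF z(1) s(1)] by (intro tendsto_vec_mult) (simp_all add: o_def)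
  moreover have "(\<lambda>n. t (r n) * z (r n)) \<longlonglongrightarrow> y"
    using LIMSEQ_subseq_LIMSEQ[OF tz(1) s(1)] by (simp add: o_def)
  ultimately show ?thesis
    using LIMSEQ_unique by blast
qed

lemma orbit_meets_complex:
  assumes "complete_fan \<Sigma>" "\<And>i. z $ i \<noteq> 0"
  shows "\<exists>t\<in>group_G a. t * z \<in> \<Z>"
proof -
  have "(\<Sum>i\<in>UNIV. - ln (norm (z $ i)) *\<^sub>R gen i) \<in> \<Union>\<Sigma>"
    using assms(1) by (simp add: complete_fan_def)
  then obtain \<sigma> where \<sigma>: "\<sigma> \<in> \<Sigma>" "(\<Sum>i\<in>UNIV. - ln (norm (z $ i)) *\<^sub>R gen i) \<in> \<sigma>"
    by blast
  obtain w where w: "\<And>i. 0 \<le> w i" "\<And>i. i \<notin> cone_indices a \<sigma> \<Longrightarrow> w i = 0"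
      "(\<Sum>i\<in>UNIV. - ln (norm (z $ i)) *\<^sub>R gen i) = (\<Sum>i\<in>UNIV. w i *\<^sub>R gen i)"
    using cone_coordinates[OF \<sigma>] by blast
  \<comment> \<open>Both families of coefficients represent the same vector, so the exponents form a
    linear relation and \<open>t\<close> lies in \<open>G\<close>. The new moduli are
    \<open>exp (- w i)\<close>, at most \<open>1\<close> and equal to \<open>1\<close> off the
    cone.\<close>
  define t where "t = (\<chi> i. complex_of_real (exp (- ln (norm (z $ i)) - w i)))"
  have "t \<in> group_G a"
    unfolding t_def using w(3)
    by (intro exp_in_group_G) (simp add: scaleR_diff_left sum_subtractf)
  have "norm ((t * z) $ i) = exp (- w i)" for i
    using assms(2)[of i] unfolding t_def
    by (simp add: norm_mult exp_diff exp_minus norm_divide norm_inverse) (simp add: divide_inverse)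
  moreover have "i \<in> cone_indices a \<sigma>" if "0 < w i" for i
    using that w(2)[of i] by force
  ultimately have "t * z \<in> \<Z>"
    unfolding mem_moment_angle_complex g_subset_def using w(1) \<sigma>(1)
    by (auto intro!: bexI[of _ \<sigma>])
  then show ?thesis using \<open>t \<in> group_G a\<close> by blast
qed

section \<open>The orbit spaces\<close>

text \<open>Compactness makes a subsequence of the translates converge in \<open>C\<close>;
  properness then places that limit in the orbit of \<open>x\<close>.\<close>

lemma limit_meets_compact:
  assumes "compact C" "C \<subseteq> \<U>"
    and "w \<longlonglongrightarrow> x" "x \<in> \<U>" "\<And>n. t n \<in> group_G a" "\<And>n. t n * w n \<in> C"
  shows "\<exists>s\<in>group_G a. s * x \<in> C"
proof -
  obtain l r where l: "l \<in> C" "strict_mono r" "((\<lambda>n. t n * w n) \<circ> r) \<longlonglongrightarrow> l"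
    using seq_compactE[OF compact_imp_seq_compact[OF assms(1)]] assms(6) by metis
  have "\<exists>s\<in>group_G a. l = s * x"
  proof (rule group_G_proper)
    show "(w \<circ> r) \<longlonglongrightarrow> x"
      using assms(3) l(2) by (rule LIMSEQ_subseq_LIMSEQ)
    show "(\<lambda>n. t (r n) * (w \<circ> r) n) \<longlonglongrightarrow> l"
      using l(3) by (simp add: o_def)
  qed (use assms l(1) in auto)
  then show ?thesis using l(1) by blast
qed

lemma orbit_G_image_complex:
  assumes "complete_fan \<Sigma>"
  shows "orbit (group_G a) ` \<Z> = orbit (group_G a) ` \<U>"
proof
  show "orbit (group_G a) ` \<Z> \<subseteq> orbit (group_G a) ` \<U>"
    using moment_angle_complex_subset by (rule image_mono)
  show "orbit (group_G a) ` \<U> \<subseteq> orbit (group_G a) ` \<Z>"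
  proof (rule image_subsetI)
    fix x assume x: "x \<in> \<U>"
    \<comment> \<open>Replacing zero coordinates by \<open>1 / (n + 1)\<close> approximates
      \<open>x\<close> from the open torus, where every orbit meets the complex.\<close>
    define w where "w n = (\<chi> i. if x $ i = 0 then complex_of_real (1 / real (Suc n)) else x $ i)" for n
    have "w n $ i \<noteq> 0" for n i
      unfolding w_def by (simp del: of_nat_Suc)
    then have "\<exists>t\<in>group_G a. t * w n \<in> \<Z>" for n
      by (rule orbit_meets_complex[OF assms])
    then obtain t where t: "\<And>n. t n \<in> group_G a" "\<And>n. t n * w n \<in> \<Z>" by metis
    have "(\<lambda>n. complex_of_real (1 / real (Suc n))) \<longlonglongrightarrow> complex_of_real 0"
      by (rule tendsto_of_real[OF LIMSEQ_Suc[OF lim_const_over_n]])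
    then have "(\<lambda>n. w n $ i) \<longlonglongrightarrow> x $ i" for i
      by (cases "x $ i = 0") (simp_all add: w_def)
    then have "w \<longlonglongrightarrow> x" by (rule vec_tendstoI)
    then obtain s where "s \<in> group_G a" "s * x \<in> \<Z>"
      using limit_meets_compact[OF compact_complex moment_angle_complex_subset _ x, of w t] t by blast
    then show "orbit (group_G a) x \<in> orbit (group_G a) ` \<Z>"
      using orbit_G_eq_iff[of a x "s * x"] by blast
  qed
qed

text \<open>A relatively closed subset of the compact complex is compact, so a limit in
  \<open>\<U>\<close> of points whose orbits meet \<open>C\<close> again has an orbit meeting
  \<open>C\<close>.\<close>

lemma closedin_orbit_G_image:
  assumes "closedin (top_of_set \<Z>) C"
  shows "closedin (orbit_space (group_G a) \<U>) (orbit (group_G a) ` C)"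
proof -
  let ?S = "{x \<in> \<U>. orbit (group_G a) x \<in> orbit (group_G a) ` C}"
  have C: "compact C" "C \<subseteq> \<U>"
    using closedin_compact[OF compact_complex assms] closedin_imp_subset[OF assms]
      moment_angle_complex_subset by blast+
  have "x \<in> ?S" if x: "x \<in> \<U>" "x \<in> closure ?S" for x
  proof -
    obtain w where w: "\<And>n. w n \<in> ?S" "w \<longlonglongrightarrow> x"
      using x(2) unfolding closure_sequential by blast
    have "\<exists>t\<in>group_G a. t * w n \<in> C" for n
      using w(1)[of n] orbit_G_eq_iff[of a "w n"] by force
    then obtain t where t: "\<And>n. t n \<in> group_G a" "\<And>n. t n * w n \<in> C" by metis
    obtain s where "s \<in> group_G a" "s * x \<in> C"
      using limit_meets_compact[OF C w(2) x(1) t] by blast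
    then have "orbit (group_G a) x \<in> orbit (group_G a) ` C"
      using orbit_G_eq_iff[of a x "s * x"] by blast
    then show ?thesis using x(1) by blast
  qed
  then have "?S = \<U> \<inter> closure ?S"
    using closure_subset[of ?S] by blast
  then have "closedin (top_of_set \<U>) ?S"
    unfolding closedin_closed by (intro exI[of _ "closure ?S"] conjI closed_closure)
  then show ?thesis
    unfolding closedin_orbit_space using C(2) by blast
qed

lemma orbit_K_eq_imp_orbit_G_eq:
  "orbit (group_K a) z = orbit (group_K a) w \<Longrightarrow> orbit (group_G a) z = orbit (group_G a) w"
  by (metis IntD1 group_K_eq orbit_G_eq_iff orbit_K_eq_iff)

lemma homeomorphic_orbit_spaces:
  assumes "complete_fan \<Sigma>"
  shows "\<exists>\<phi>. homeomorphic_map (orbit_space (group_K a) \<Z>) (orbit_space (group_G a) \<U>) \<phi> \<and>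
           (\<forall>z\<in>\<Z>. \<phi> (orbit (group_K a) z) = orbit (group_G a) z)"
proof -
  have "continuous_map (top_of_set \<U>) (orbit_space (group_G a) \<U>) (orbit (group_G a))"
    by (rule quotient_imp_continuous_map[OF quotient_map_orbit])
  then have "continuous_map (top_of_set \<Z>) (orbit_space (group_G a) \<U>) (orbit (group_G a))"
    by (rule continuous_map_from_subtopology_mono) (rule moment_angle_complex_subset)
  \<comment> \<open>The map descends to the quotient because \<open>K\<close> is contained in
    \<open>G\<close>, so it is constant on \<open>K\<close>-orbits.\<close>
  then obtain \<phi> where cont: "continuous_map (orbit_space (group_K a) \<Z>) (orbit_space (group_G a) \<U>) \<phi>"
      and \<phi>: "\<And>z. z \<in> \<Z> \<Longrightarrow> \<phi> (orbit (group_K a) z) = orbit (group_G a) z"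
    using quotient_map_lift_exists[OF quotient_map_orbit] orbit_K_eq_imp_orbit_G_eq
    by (metis topspace_euclidean_subtopology)
  have image: "\<phi> ` orbit (group_K a) ` C = orbit (group_G a) ` C" if "C \<subseteq> \<Z>" for C
    unfolding image_image using that by (intro image_cong refl \<phi>) blast
  have "homeomorphic_map (orbit_space (group_K a) \<Z>) (orbit_space (group_G a) \<U>) \<phi>"
  proof (rule bijective_closed_imp_homeomorphic_map[OF cont])
    show "closed_map (orbit_space (group_K a) \<Z>) (orbit_space (group_G a) \<U>) \<phi>"
      unfolding closed_map_def
    proof (intro allI impI)
      fix C assume C: "closedin (orbit_space (group_K a) \<Z>) C"
      let ?D = "{z \<in> \<Z>. orbit (group_K a) z \<in> C}"
      \<comment> \<open>Passing to the preimage in the complex reduces closedness of the induced map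
        to that of the orbit map on closed subsets.\<close>
      have "C = orbit (group_K a) ` ?D"
        using C unfolding closedin_orbit_space by blast
      moreover have "\<phi> ` orbit (group_K a) ` ?D = orbit (group_G a) ` ?D"
        by (rule image) blast
      moreover have "closedin (top_of_set \<Z>) ?D"
        using C unfolding closedin_orbit_space by blast
      ultimately show "closedin (orbit_space (group_G a) \<U>) (\<phi> ` C)"
        using closedin_orbit_G_image by simp
    qed
    show "\<phi> ` topspace (orbit_space (group_K a) \<Z>) = topspace (orbit_space (group_G a) \<U>)"
      by (simp add: topspace_orbit_space image orbit_G_image_complex[OF assms])
    show "inj_on \<phi> (topspace (orbit_space (group_K a) \<Z>))"
      unfolding topspace_orbit_space
    \<comment> \<open>Two points of the complex in one \<open>G\<close>-orbit differ by an element
      that keeps the first point in the complex, hence by an element of \<open>K\<close>.\<close>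
    proof (rule inj_onI, clarify)
      fix z w assume zw: "z \<in> \<Z>" "w \<in> \<Z>"
        and "\<phi> (orbit (group_K a) z) = \<phi> (orbit (group_K a) w)"
      then have "orbit (group_G a) z = orbit (group_G a) w" by (simp add: \<phi>)
      then obtain t where "t \<in> group_G a" "w = t * z"
        unfolding orbit_G_eq_iff by blast
      then show "orbit (group_K a) z = orbit (group_K a) w"
        unfolding orbit_K_eq_iff using group_G_meets_complex_in_K zw by blast
    qed
  qed
  then show ?thesis using \<phi> by blast
qed

end

theorem theorem3p4:
  fixes \<Sigma> :: "(real ^ 'n::finite) set set"
    and a :: "'m::finite \<Rightarrow> int ^ 'n"
  assumes "simplicial_fan \<Sigma>"
    and "span (\<Union> (rays \<Sigma>)) = UNIV"
    and "ray_generators \<Sigma> a"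
  shows "(complete_fan \<Sigma> \<longrightarrow>
           (\<exists>\<phi>. homeomorphic_map
                   (orbit_space (group_K a) (moment_angle_complex \<Sigma> a))
                   (orbit_space (group_G a) (arrangement_complement \<Sigma> a)) \<phi> \<and>
                (\<forall>z\<in>moment_angle_complex \<Sigma> a. \<phi> (orbit (group_K a) z) = orbit (group_G a) z)))
       \<and> (\<exists>r. equivariant_deformation_retraction compact_torus
                (arrangement_complement \<Sigma> a) (moment_angle_complex \<Sigma> a) r)"
proof -
  interpret simplicial_fan_rays \<Sigma> a
    using assms(1,3) by unfold_locales
  have "equivariant_deformation_retraction compact_torus \<U> \<Z> (shrink \<Sigma> a 1)"
    by (rule equivariant_deformation_retraction_shrink[OF fan_nonempty])
  then show ?thesis
    by (intro conjI impI homeomorphic_orbit_spaces exI[of _ "shrink \<Sigma> a 1"])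
qed

end
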